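(* There exists an absolute constant $c_3\in\left(0,\frac14\right)$ such that the following holds for all sufficiently large real $x$ and all real $y\geqslant1$. If $y\leqslant c_3\,x^{11/20}$, then $$\sum_{x<n\leqslant x+y}(\lambda_5\star\mathbf{1})(n)\ll\left(x^{1/12}+yx^{-4/9}\right)\log x.$$ Furthermore, if $y\leqslant c_3\,x^{19/36}$, then $$\sum_{x<n\leqslant x+y}(\lambda_5\star\mathbf{1})(n)\ll x^{1/12}\log x.$$
   Context: $\tau(n)$ is the number of positive divisors of $n$, $\lambda_5(n):=\left(\frac{\tau(n)}{5}\right)$ with $\left(\frac{\cdot}{5}\right)$ the Legendre symbol modulo $5$, and $(\lambda_5\star\mathbf{1})(n)=\sum_{d\mid n}\lambda_5(d)$. In the paper, $c_3=c_3(5/2)$ is the constant from a result of Filaseta–Trifonov on integer points near the curve $X/n^{5/2}$. *)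

theory Defs
  imports "HOL-Analysis.Analysis" "HOL-Number_Theory.Number_Theory"
begin

text \<open>
  All functions below are meant for positive arguments;
  at \<open>n = 0\<close> they take junk values.
\<close>

definition tau :: "nat \<Rightarrow> nat" where
  "tau n = card {d. d dvd n}"

definition lambda5 :: "nat \<Rightarrow> int" where
  "lambda5 n = Legendre (int (tau n)) 5"

text \<open>The Dirichlet convolution of \<open>lambda5\<close> with the constant function \<open>1\<close>.\<close>

definition lambda5_conv_one :: "nat \<Rightarrow> int" where
  "lambda5_conv_one n = (\<Sum>d | d dvd n. lambda5 d)"

end

theory Submission
  imports Defs
begin

text \<open>
  On a prime power, \<open>lambda5_conv_one\<close> takes the values 1, 0, -1, 0, 0 periodically in the exponent, so it is
  bounded by 1 and supported on the numbers \<open>a\<^sup>2 * b ^ 5\<close>. It suffices to count the \<open>b\<close> in a dyadic range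
  \<open>b \<sim> N\<close>, \<open>x powr (1/12) \<le> N \<le> x powr (1/6)\<close>, for which \<open>sqrt x / b powr (5/2)\<close> lies very close to an
  integer (small \<open>b\<close> and small \<open>a\<close> are trivial). Following Filaseta and Trifonov, two such points
  \<open>u\<close>, \<open>u + a\<close> are combined with Pade coefficients into integers approximating quantities of size
  \<open>a ^ (2 * k - 1) * sqrt x / N powr (k + 5/2)\<close> for \<open>k = 1, 2, 3\<close>. For a fixed gap \<open>a\<close> between consecutive
  points, the integer for \<open>k = 3\<close> takes few values; points sharing a value form a short cluster, in which
  the integer for \<open>k = 2\<close> is injective and takes few values. The integers for \<open>k = 1, 2\<close> also exclude very short
  gaps. Summing over the gaps up to \<open>N / x powr (1/12)\<close> gives \<open>O(x powr (1/12))\<close> points in each dyadic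
  range. The bound for longer intervals follows by cutting them into pieces of length about \<open>x powr (19/36)\<close>.
\<close>

section \<open>The support of the convolution\<close>

lemma coprime_divisor_split:
  fixes a b :: nat
  assumes "coprime a b" "a * b > 0"
  shows "bij_betw (\<lambda>(d, e). d * e) ({d. d dvd a} \<times> {e. e dvd b}) {d. d dvd a * b}"
proof (rule bij_betwI')
  fix s t assume s: "s \<in> {d. d dvd a} \<times> {e. e dvd b}" and t: "t \<in> {d. d dvd a} \<times> {e. e dvd b}"
  obtain d e d' e' where st: "s = (d, e)" "t = (d', e')" by fastforce
  have c: "coprime d e'" "coprime d' e"
    using s t st assms(1) by (auto intro: coprime_divisors)
  have dv: "d dvd d'" "d' dvd d" if eq: "d * e = d' * e'"
    using c eq by (metis coprime_dvd_mult_left_iff dvd_triv_left)+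
  have "d > 0" using s st assms(2) dvd_pos_nat by auto
  then show "((case s of (d, e) \<Rightarrow> d * e) = (case t of (d, e) \<Rightarrow> d * e)) = (s = t)"
    using dv dvd_antisym[of d d'] st by auto
next
  fix s assume "s \<in> {d. d dvd a} \<times> {e. e dvd b}"
  then show "(case s of (d, e) \<Rightarrow> d * e) \<in> {d. d dvd a * b}"
    by (auto intro: mult_dvd_mono)
next
  fix y assume "y \<in> {d. d dvd a * b}"
  then obtain d e where "y = d * e" "d dvd a" "e dvd b"
    by (auto elim: dvd_productE)
  then show "\<exists>s\<in>{d. d dvd a} \<times> {e. e dvd b}. y = (case s of (d, e) \<Rightarrow> d * e)"
    by force
qed

text \<open>Kept general in \<open>F\<close> and its semiring because it serves twice: with the
  constant 1 for \<open>tau\<close> and with \<open>lambda5\<close> for the convolution.\<close>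

lemma sum_divisors_coprime_mult:
  fixes F :: "nat \<Rightarrow> 'a :: comm_semiring_1"
  assumes "coprime a b" "a * b > 0" and F: "\<And>d e. coprime d e \<Longrightarrow> d * e > 0 \<Longrightarrow> F (d * e) = F d * F e"
  shows "(\<Sum>d | d dvd a * b. F d) = (\<Sum>d | d dvd a. F d) * (\<Sum>d | d dvd b. F d)"
proof -
  have "(\<Sum>d | d dvd a * b. F d) = (\<Sum>(d, e)\<in>{d. d dvd a} \<times> {e. e dvd b}. F (d * e))"
    using sum.reindex_bij_betw[OF coprime_divisor_split[OF assms(1,2)], of F]
    by (simp add: case_prod_unfold)
  also have "\<dots> = (\<Sum>(d, e)\<in>{d. d dvd a} \<times> {e. e dvd b}. F d * F e)"
  proof (intro sum.cong refl, clarify)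
    fix d e assume "d dvd a" "e dvd b"
    then have "coprime d e" "d * e > 0"
      using assms(1,2) coprime_divisors dvd_pos_nat by auto
    then show "F (d * e) = F d * F e" by (rule F)
  qed
  also have "\<dots> = (\<Sum>d | d dvd a. F d) * (\<Sum>d | d dvd b. F d)"
    by (simp add: sum_product sum.cartesian_product)
  finally show ?thesis .
qed

section \<open>Multiplicativity and the Legendre symbol modulo 5\<close>

lemma tau_coprime_mult:
  assumes "coprime a b" "a * b > 0"
  shows "tau (a * b) = tau a * tau b"
  using sum_divisors_coprime_mult[OF assms, of "\<lambda>_. 1 :: nat"] by (simp add: tau_def)

lemma Legendre_5:
  "Legendre a 5 = (if a mod 5 = 0 then 0 else if a mod 5 \<in> {1, 4} then 1 else - 1)"
proof -
  have sq: "y\<^sup>2 mod 5 = 0 \<or> y\<^sup>2 mod 5 = 1 \<or> y\<^sup>2 mod 5 = 4" for y :: int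
  proof -
    consider "y mod 5 = 0" | "y mod 5 = 1" | "y mod 5 = 2" | "y mod 5 = 3" | "y mod 5 = 4"
      by fastforce
    then show ?thesis by cases (simp_all flip: power_mod[of y 5 2])
  qed
  have "a mod 5 \<in> {0, 1, 2, 3, 4}" by auto
  moreover have "QuadRes 5 a" if "a mod 5 = 1" unfolding QuadRes_def cong_def
    by (rule exI[of _ 1]) (use that in simp)
  moreover have "QuadRes 5 a" if "a mod 5 = 4" unfolding QuadRes_def cong_def
    by (rule exI[of _ 2]) (use that in simp)
  moreover have "\<not> QuadRes 5 a" if "a mod 5 = 2 \<or> a mod 5 = 3"
  proof
    assume "QuadRes 5 a"
    then obtain y where "y\<^sup>2 mod 5 = a mod 5" unfolding QuadRes_def cong_def by blast
    then show False using sq[of y] that by presburger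
  qed
  ultimately show ?thesis unfolding Legendre_def cong_def by auto
qed

lemma Legendre_5_mult: "Legendre (a * b) 5 = Legendre a 5 * Legendre b 5"
proof -
  have r: "c mod 5 = 0 \<or> c mod 5 = 1 \<or> c mod 5 = 2 \<or> c mod 5 = 3 \<or> c mod 5 = 4" for c :: int
    by auto
  have "a * b mod 5 = (a mod 5) * (b mod 5) mod 5" by (simp add: mod_mult_eq)
  then show ?thesis unfolding Legendre_5 using r[of a] r[of b] by (elim disjE) simp_all
qed

lemma lambda5_coprime_mult:
  assumes "coprime a b" "a * b > 0"
  shows "lambda5 (a * b) = lambda5 a * lambda5 b"
  by (simp add: lambda5_def tau_coprime_mult[OF assms] Legendre_5_mult)

lemma lambda5_conv_one_coprime_mult:
  assumes "coprime a b" "a * b > 0"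
  shows "lambda5_conv_one (a * b) = lambda5_conv_one a * lambda5_conv_one b"
  unfolding lambda5_conv_one_def
  by (rule sum_divisors_coprime_mult[OF assms lambda5_coprime_mult])

section \<open>Values at prime powers and the support\<close>

lemma divisors_prime_power:
  fixes p :: nat
  assumes "prime p"
  shows "{d. d dvd p ^ k} = (\<lambda>i. p ^ i) ` {..k}" "inj_on (\<lambda>i. p ^ i) {..k}"
proof -
  show "{d. d dvd p ^ k} = (\<lambda>i. p ^ i) ` {..k}"
    using divides_primepow_nat[OF assms] by (auto simp: le_imp_power_dvd)
  show "inj_on (\<lambda>i. p ^ i) {..k}"
    using prime_gt_1_nat[OF assms] by (auto intro!: inj_onI)
qed

lemma lambda5_prime_power:
  assumes "prime p"
  shows "lambda5 (p ^ k) = Legendre (int k + 1) 5"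
  by (simp add: lambda5_def tau_def divisors_prime_power[OF assms] card_image add.commute)

text \<open>Since \<open>tau (p ^ i) = i + 1\<close>, this is a partial sum of the sequence 1, -1,
  -1, 1, 0, repeated with period 5; a full period sums to 0.\<close>

lemma lambda5_conv_one_prime_power:
  assumes "prime p"
  shows "lambda5_conv_one (p ^ k) = (if k mod 5 = 0 then 1 else if k mod 5 = 2 then - 1 else 0)"
proof -
  have "lambda5_conv_one (p ^ k) = (\<Sum>i\<le>k. Legendre (int i + 1) 5)"
    by (simp add: lambda5_conv_one_def divisors_prime_power[OF assms] sum.reindex
        lambda5_prime_power[OF assms])
  also have "\<dots> = (if k mod 5 = 0 then 1 else if k mod 5 = 2 then - 1 else 0)"
  proof (induction k)
    case 0
    then show ?case by (simp add: Legendre_5)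
  next
    case (Suc k)
    have *: "(int (Suc k) + 1) mod 5 = int ((k mod 5 + 2) mod 5)"
      by (simp add: zmod_int mod_add_right_eq add.commute)
    have "k mod 5 \<in> {0, 1, 2, 3, 4}" by auto
    then show ?case unfolding sum.atMost_Suc Suc.IH Legendre_5[of "int (Suc k) + 1"] *
      by (auto simp: mod_Suc)
  qed
  finally show ?thesis .
qed

text \<open>Strong induction that splits off the full power \<open>p ^ k\<close> of one prime. A
  nonzero value forces \<open>k = 5 * q\<close> or \<open>k = 5 * q + 2\<close>: then
  \<open>p ^ q\<close> goes into \<open>b\<close>, and in the second case one \<open>p\<close> goes
  into \<open>a\<close>.\<close>

lemma lambda5_conv_one_support:
  assumes "n > 0"
  shows "\<bar>lambda5_conv_one n\<bar> \<le> 1 \<and> (lambda5_conv_one n \<noteq> 0 \<longrightarrow> (\<exists>a b. n = a ^ 2 * b ^ 5))"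
  using assms
proof (induction n rule: less_induct)
  case (less n)
  show ?case
  proof (cases "n = 1")
    case True
    have "lambda5_conv_one n = 1" using lambda5_conv_one_prime_power[of 2 0] True by simp
    then show ?thesis using True by (auto intro!: exI[of _ 1])
  next
    case False
    then obtain p where p: "prime p" "p dvd n" using prime_factor_nat by auto
    define k where "k = multiplicity p n"
    obtain m where m: "n = p ^ k * m" "\<not> p dvd m"
      using multiplicity_decompose'[of n p] less.prems p
      by (metis k_def not_prime_unit not_gr_zero)
    have k: "k > 0" using m p by (cases k) auto
    have mpos: "m > 0" using m less.prems by (cases m) auto
    have "p ^ k > 1" using prime_gt_1_nat[OF p(1)] k by (rule one_less_power)
    then have mn: "m < n" using m mpos by simp
    have cop: "coprime (p ^ k) m" using p m by (simp add: prime_imp_coprime)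
    have f: "lambda5_conv_one n = lambda5_conv_one (p ^ k) * lambda5_conv_one m"
      using lambda5_conv_one_coprime_mult[OF cop] m less.prems by simp
    note IH = less.IH[OF mn mpos]
    have "\<exists>a b. n = a ^ 2 * b ^ 5" if ne: "lambda5_conv_one n \<noteq> 0"
    proof -
      obtain a b where ab: "m = a ^ 2 * b ^ 5" using IH ne f by auto
      have "k mod 5 = 0 \<or> k mod 5 = 2"
        using ne f lambda5_conv_one_prime_power[OF p(1), of k] by (auto split: if_splits)
      then consider "k = 5 * (k div 5)" | "k = 5 * (k div 5) + 2"
        using mult_div_mod_eq[of 5 k] by fastforce
      then show ?thesis
      proof cases
        case 1
        have "n = (p ^ (k div 5)) ^ 5 * m" using m 1 by (metis mult.commute power_mult)
        then have "n = a ^ 2 * (p ^ (k div 5) * b) ^ 5" using ab by (simp add: power_mult_distrib)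
        then show ?thesis by blast
      next
        case 2
        have "p ^ k = (p ^ (k div 5)) ^ 5 * p ^ 2"
          by (metis 2 mult.commute power_add power_mult)
        then have "n = (p * a) ^ 2 * (p ^ (k div 5) * b) ^ 5"
          using ab m by (simp add: power_mult_distrib)
        then show ?thesis by blast
      qed
    qed
    moreover have "\<bar>lambda5_conv_one n\<bar> \<le> 1"
      unfolding f abs_mult using IH lambda5_conv_one_prime_power[OF p(1), of k] by auto
    ultimately show ?thesis by blast
  qed
qed

section \<open>Counting spaced sets of integers\<close>

lemma card_le_card_image_times:
  fixes B :: real
  assumes "finite A" and B: "\<And>c. c \<in> g ` A \<Longrightarrow> real (card {x \<in> A. g x = c}) \<le> B"
  shows "real (card A) \<le> real (card (g ` A)) * B"
proof -
  have "real (card A) = (\<Sum>c\<in>g ` A. real (card {x \<in> A. g x = c}))"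
    using sum.image_gen[OF assms(1), of "\<lambda>_. 1 :: real" g] by simp
  also have "\<dots> \<le> real (card (g ` A)) * B"
    using sum_bounded_above[of "g ` A" "\<lambda>c. real (card {x \<in> A. g x = c})" B] B by simp
  finally show ?thesis .
qed

lemma card_ints_in_interval:
  fixes S :: "int set"
  assumes "0 \<le> L" and "\<And>i. i \<in> S \<Longrightarrow> l \<le> real_of_int i \<and> real_of_int i \<le> l + L"
  shows "real (card S) \<le> L + 1"
proof -
  have "S \<subseteq> {\<lceil>l\<rceil>..\<lfloor>l + L\<rfloor>}" using assms(2) by (auto simp: ceiling_le_iff le_floor_iff)
  then have "card S \<le> nat (\<lfloor>l + L\<rfloor> - \<lceil>l\<rceil> + 1)"
    using card_mono[of "{\<lceil>l\<rceil>..\<lfloor>l + L\<rfloor>}" S] by simp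
  moreover have "real (nat (\<lfloor>l + L\<rfloor> - \<lceil>l\<rceil> + 1)) \<le> L + 1"
    using assms(1) by linarith
  ultimately show ?thesis by linarith
qed

text \<open>Measuring from the least element in units of \<open>d\<close> and taking floors is
  strictly increasing on \<open>S\<close>, so \<open>S\<close> injects into the integers between 0
  and \<open>L / d\<close>.\<close>

lemma card_spaced:
  fixes S :: "nat set"
  assumes "finite S" "0 < d" "0 \<le> L"
    and spaced: "\<And>u w. u \<in> S \<Longrightarrow> w \<in> S \<Longrightarrow> u < w \<Longrightarrow> d \<le> real w - real u"
    and diam: "\<And>u w. u \<in> S \<Longrightarrow> w \<in> S \<Longrightarrow> u < w \<Longrightarrow> real w - real u \<le> L"
  shows "real (card S) \<le> L / d + 1"
proof (cases "S = {}")
  case False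
  define m where "m = Min S"
  have m: "m \<in> S" "\<And>u. u \<in> S \<Longrightarrow> m \<le> u" using assms(1) False by (auto simp: m_def)
  define g where "g u = \<lfloor>(real u - real m) / d\<rfloor>" for u
  have lt: "g u < g w" if "u \<in> S" "w \<in> S" "u < w" for u w
  proof -
    have "(real u - real m) / d + 1 \<le> (real w - real m) / d"
      using divide_right_mono[OF spaced[OF that], of d] assms(2) by (simp add: diff_divide_distrib)
    then show ?thesis unfolding g_def by linarith
  qed
  then have "inj_on g S"
    by (intro linorder_inj_onI) (auto simp: order_less_imp_not_eq)
  then have "card S = card (g ` S)" by (simp add: card_image)
  moreover have "real (card (g ` S)) \<le> L / d + 1"
  proof (rule card_ints_in_interval)
    fix i assume "i \<in> g ` S"
    then obtain u where u: "u \<in> S" "i = g u" by blast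
    have "0 \<le> real u - real m" "real u - real m \<le> L"
      using m u diam[of m u] assms(3) by (cases "u = m"; force)+
    then have "0 \<le> (real u - real m) / d" "(real u - real m) / d \<le> L / d"
      using assms(2) by (auto intro: divide_right_mono)
    then show "0 \<le> real_of_int i \<and> real_of_int i \<le> 0 + L / d"
      unfolding u(2) g_def by (auto intro: order_trans[OF of_int_floor_le])
  qed (use assms in simp)
  ultimately show ?thesis by simp
qed (use assms in simp)

text \<open>For \<open>a \<ge> 1\<close> the term is at most \<open>2 / a - 2 / (a + 1)\<close>,
  which telescopes from \<open>Min T\<close> on.\<close>

lemma sum_inverse_squares_le:
  fixes r :: real
  assumes "finite T" "0 < r" and T: "\<And>a. a \<in> T \<Longrightarrow> 1 \<le> a \<and> r \<le> real a"
  shows "(\<Sum>a\<in>T. 1 / (real a)\<^sup>2) \<le> 2 / r"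
proof (cases "T = {}")
  case False
  define k where "k = Min T"
  have k: "k \<in> T" "\<And>a. a \<in> T \<Longrightarrow> k \<le> a" using assms(1) False by (auto simp: k_def)
  have tele: "(\<Sum>a\<in>{k..<k + j}. 1 / (real a)\<^sup>2) \<le> 2 / real k - 2 / real (k + j)" for j
  proof (induction j)
    case (Suc j)
    have pos: "real (k + j) \<ge> 1" using T[OF k(1)] by simp
    have "1 / (real (k + j))\<^sup>2 \<le> 2 / real (k + j) - 2 / (real (k + j) + 1)"
      using pos mult_left_mono[OF pos, of "real (k + j)"] by (simp add: divide_simps power2_eq_square)
    then show ?case using Suc.IH by (simp add: add.commute)
  qed simp
  obtain M where M: "\<And>a. a \<in> T \<Longrightarrow> a < M" using assms(1) finite_nat_set_iff_bounded by metis
  have "(\<Sum>a\<in>T. 1 / (real a)\<^sup>2) \<le> (\<Sum>a\<in>{k..<k + M}. 1 / (real a)\<^sup>2)"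
    by (rule sum_mono2) (use k M in \<open>auto simp: trans_less_add2\<close>)
  also have "\<dots> \<le> 2 / real k" using tele[of M] by (smt (verit) divide_nonneg_nonneg of_nat_0_le_iff)
  also have "\<dots> \<le> 2 / r" using T[OF k(1)] assms(2) by (intro divide_left_mono) auto
  finally show ?thesis .
qed (use assms in simp)

text \<open>The gap is taken to the next point of \<open>S\<close>, not to an arbitrary one. Hence
  two starting points are themselves at least \<open>a\<close> apart, which later separates the
  values of the forms.\<close>

definition gap_starts :: "nat set \<Rightarrow> nat \<Rightarrow> nat set" where
  "gap_starts S a = {u \<in> S. u + a \<in> S \<and> (\<forall>w\<in>S. u < w \<longrightarrow> u + a \<le> w)}"

text \<open>Points followed by no point closer than \<open>A\<close>, the last point among them, are
  \<open>A\<close>-spaced and number at most \<open>L / A + 1\<close>. Every other point is counted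
  by the gap to its successor.\<close>

lemma card_le_sum_gap_starts:
  fixes A L :: real
  assumes fin: "finite S" and "0 < A" "0 \<le> L"
    and diam: "\<And>u w. u \<in> S \<Longrightarrow> w \<in> S \<Longrightarrow> u < w \<Longrightarrow> real w - real u \<le> L"
  shows "real (card S) \<le> L / A + 1 + (\<Sum>a | 1 \<le> a \<and> real a \<le> A. real (card (gap_starts S a)))"
proof -
  define B where "B = {u \<in> S. \<forall>w\<in>S. u < w \<longrightarrow> A \<le> real w - real u}"
  define I where "I = {a :: nat. 1 \<le> a \<and> real a \<le> A}"
  have finI: "finite I"
    by (rule finite_subset[of _ "{..nat \<lfloor>A\<rfloor>}"]) (auto simp: I_def le_nat_floor)
  have "S \<subseteq> B \<union> (\<Union>a\<in>I. gap_starts S a)"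
  proof
    fix u assume u: "u \<in> S"
    show "u \<in> B \<union> (\<Union>a\<in>I. gap_starts S a)"
    proof (cases "u \<in> B")
      case False
      then obtain w where w: "w \<in> S" "u < w" "real w - real u < A" using u by (auto simp: B_def)
      define v where "v = Min {w \<in> S. u < w}"
      have "finite {w \<in> S. u < w}" "w \<in> {w \<in> S. u < w}" using fin w by auto
      then have v: "v \<in> S" "u < v" "\<And>w'. w' \<in> S \<Longrightarrow> u < w' \<Longrightarrow> v \<le> w'"
        using Min_in[of "{w \<in> S. u < w}"] unfolding v_def by (blast, blast, simp_all)
      have "v \<le> w" using v w by blast
      then have "real v - real u \<le> A" using w by linarith
      then have "u \<in> gap_starts S (v - u)" "v - u \<in> I" using u v w by (auto simp: gap_starts_def I_def)
      then show ?thesis by blast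
    qed simp
  qed
  moreover have fing: "finite (gap_starts S a)" for a using fin by (simp add: gap_starts_def)
  moreover have finB: "finite B" using fin by (simp add: B_def)
  ultimately have "card S \<le> card (B \<union> (\<Union>a\<in>I. gap_starts S a))" using finI by (intro card_mono) auto
  also have "\<dots> \<le> card B + card (\<Union>a\<in>I. gap_starts S a)" by (rule card_Un_le)
  also have "\<dots> \<le> card B + (\<Sum>a\<in>I. card (gap_starts S a))" using card_UN_le[OF finI] by simp
  finally have "real (card S) \<le> real (card B) + (\<Sum>a\<in>I. real (card (gap_starts S a)))"
    by (simp flip: of_nat_add of_nat_sum)
  moreover have "real (card B) \<le> L / A + 1"
    by (rule card_spaced[OF finB assms(2,3)]) (auto simp: B_def intro: diam)
  ultimately show ?thesis by (simp add: I_def)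
qed

section \<open>Pade forms of the function with exponent -5/2\<close>

text \<open>
  The polynomial coefficients are the diagonal Pade numerators and denominators of \<open>(1 + z) powr (-5/2)\<close>,
  made homogeneous: \<open>pade1\<close>, \<open>pade2\<close> and \<open>pade3\<close> vanish on the diagonal \<open>u = v\<close> to order 1, 3 and 5.
  In terms of \<open>p = sqrt u\<close> and \<open>q = sqrt v\<close> they are a power of \<open>q - p\<close> times a form with positive
  coefficients, which gives two-sided bounds without any Taylor expansion. The functions \<open>pade2'\<close> and
  \<open>pade3'\<close> are the negated derivatives along \<open>u \<mapsto> (u, u + a)\<close>.
\<close>

definition pade1 :: "real \<Rightarrow> real \<Rightarrow> real" where
  "pade1 u v = u powr (-5/2) - v powr (-5/2)"

definition pade2 :: "real \<Rightarrow> real \<Rightarrow> real" where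
  "pade2 u v = (7 * v - 3 * u) * v powr (-5/2) + (3 * v - 7 * u) * u powr (-5/2)"

definition pade3 :: "real \<Rightarrow> real \<Rightarrow> real" where
  "pade3 u v = (21 * u\<^sup>2 - 6 * u * v + v\<^sup>2) * u powr (-5/2)
     - (21 * v\<^sup>2 - 6 * u * v + u\<^sup>2) * v powr (-5/2)"

definition pade2' :: "real \<Rightarrow> real \<Rightarrow> real" where
  "pade2' u v = 3/2 * ((9 * v - 5 * u) * v powr (-7/2) + (5 * v - 9 * u) * u powr (-7/2))"

definition pade3' :: "real \<Rightarrow> real \<Rightarrow> real" where
  "pade3' u v = 1/2 * ((33 * u\<^sup>2 - 22 * u * v + 5 * v\<^sup>2) * u powr (-7/2)
  - (33 * v\<^sup>2 - 22 * u * v + 5 * u\<^sup>2) * v powr (-7/2))"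

lemma powr_half_eq_sqrt:
  assumes "u > 0"
  shows "u powr (-5/2) = 1 / sqrt u ^ 5" "u powr (-7/2) = 1 / sqrt u ^ 7"
proof -
  have "sqrt u ^ n = u powr (real n / 2)" for n
    using assms by (simp add: powr_half_sqrt[symmetric] powr_powr flip: powr_realpow)
  then show "u powr (-5/2) = 1 / sqrt u ^ 5" "u powr (-7/2) = 1 / sqrt u ^ 7"
    by (simp_all add: powr_minus_divide flip: minus_divide_left)
qed

section \<open>Factorisations in the square roots of the variables\<close>

context
  fixes p q :: real
  assumes p: "p > 0" and q: "q > 0"
begin

text \<open>The exponent 1 is written out to match the shape of
  \<open>homogeneous_quotient_bounds\<close> with \<open>j = 1\<close>.\<close>

lemma pade1_factor:
  "1 / p ^ 5 - 1 / q ^ 5 = (q - p) ^ 1 * (q^4 + q^3*p + q^2*p^2 + q*p^3 + p^4) / (p * q) ^ 5"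
proof -
  have "1 / p ^ 5 - 1 / q ^ 5 = (q ^ 5 - p ^ 5) / (p * q) ^ 5"
    using p q by (simp add: field_simps)
  also have "q ^ 5 - p ^ 5 = (q - p) ^ 1 * (q^4 + q^3*p + q^2*p^2 + q*p^3 + p^4)" by (simp add: algebra_simps eval_nat_numeral)
  finally show ?thesis .
qed

lemma pade2_factor:
  "(7 * q\<^sup>2 - 3 * p\<^sup>2) * (1 / q ^ 5) + (3 * q\<^sup>2 - 7 * p\<^sup>2) * (1 / p ^ 5)
    = (q - p) ^ 3 * (3*q^4 + 9*q^3*p + 11*q^2*p^2 + 9*q*p^3 + 3*p^4) / (p * q) ^ 5"
proof -
  have "(7 * q\<^sup>2 - 3 * p\<^sup>2) * (1 / q ^ 5) + (3 * q\<^sup>2 - 7 * p\<^sup>2) * (1 / p ^ 5)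
    = ((7 * q\<^sup>2 - 3 * p\<^sup>2) * p ^ 5 + (3 * q\<^sup>2 - 7 * p\<^sup>2) * q ^ 5) / (p * q) ^ 5"
    using p q by (simp add: add_divide_distrib power_mult_distrib)
  also have "(7 * q\<^sup>2 - 3 * p\<^sup>2) * p ^ 5 + (3 * q\<^sup>2 - 7 * p\<^sup>2) * q ^ 5
    = (q - p) ^ 3 * (3*q^4 + 9*q^3*p + 11*q^2*p^2 + 9*q*p^3 + 3*p^4)" by (simp add: algebra_simps eval_nat_numeral)
  finally show ?thesis .
qed

lemma pade3_factor:
  "(21 * p^4 - 6 * p\<^sup>2 * q\<^sup>2 + q^4) * (1 / p ^ 5) - (21 * q^4 - 6 * p\<^sup>2 * q\<^sup>2 + p^4) * (1 / q ^ 5)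
    = (q - p) ^ 5 * (q^4 + 5*q^3*p + 9*q^2*p^2 + 5*q*p^3 + p^4) / (p * q) ^ 5"
proof -
  have "(21 * p^4 - 6 * p\<^sup>2 * q\<^sup>2 + q^4) * (1 / p ^ 5) - (21 * q^4 - 6 * p\<^sup>2 * q\<^sup>2 + p^4) * (1 / q ^ 5)
    = ((21 * p^4 - 6 * p\<^sup>2 * q\<^sup>2 + q^4) * q ^ 5 - (21 * q^4 - 6 * p\<^sup>2 * q\<^sup>2 + p^4) * p ^ 5) / (p * q) ^ 5"
    using p q by (simp add: diff_divide_distrib power_mult_distrib)
  also have "(21 * p^4 - 6 * p\<^sup>2 * q\<^sup>2 + q^4) * q ^ 5 - (21 * q^4 - 6 * p\<^sup>2 * q\<^sup>2 + p^4) * p ^ 5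
    = (q - p) ^ 5 * (q^4 + 5*q^3*p + 9*q^2*p^2 + 5*q*p^3 + p^4)" by (simp add: algebra_simps eval_nat_numeral)
  finally show ?thesis .
qed

lemma pade2_deriv_factor:
  "(9 * q\<^sup>2 - 5 * p\<^sup>2) * (1 / q ^ 7) + (5 * q\<^sup>2 - 9 * p\<^sup>2) * (1 / p ^ 7)
    = (q - p) ^ 3 * (5*q^6 + 15*q^5*p + 21*q^4*p^2 + 23*q^3*p^3 + 21*q^2*p^4 + 15*q*p^5 + 5*p^6)
        / (p * q) ^ 7"
proof -
  have "(9 * q\<^sup>2 - 5 * p\<^sup>2) * (1 / q ^ 7) + (5 * q\<^sup>2 - 9 * p\<^sup>2) * (1 / p ^ 7)
    = ((9 * q\<^sup>2 - 5 * p\<^sup>2) * p ^ 7 + (5 * q\<^sup>2 - 9 * p\<^sup>2) * q ^ 7) / (p * q) ^ 7"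
    using p q by (simp add: add_divide_distrib power_mult_distrib)
  also have "(9 * q\<^sup>2 - 5 * p\<^sup>2) * p ^ 7 + (5 * q\<^sup>2 - 9 * p\<^sup>2) * q ^ 7
    = (q - p) ^ 3 * (5*q^6 + 15*q^5*p + 21*q^4*p^2 + 23*q^3*p^3 + 21*q^2*p^4 + 15*q*p^5 + 5*p^6)"
    by (simp add: algebra_simps eval_nat_numeral)
  finally show ?thesis .
qed

lemma pade3_deriv_factor:
  "(33 * p^4 - 22 * p\<^sup>2 * q\<^sup>2 + 5 * q^4) * (1 / p ^ 7) - (33 * q^4 - 22 * p\<^sup>2 * q\<^sup>2 + 5 * p^4) * (1 / q ^ 7)
    = (q - p) ^ 5 * (5*q^6 + 25*q^5*p + 53*q^4*p^2 + 65*q^3*p^3 + 53*q^2*p^4 + 25*q*p^5 + 5*p^6)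
        / (p * q) ^ 7"
proof -
  have "(33 * p^4 - 22 * p\<^sup>2 * q\<^sup>2 + 5 * q^4) * (1 / p ^ 7) - (33 * q^4 - 22 * p\<^sup>2 * q\<^sup>2 + 5 * p^4) * (1 / q ^ 7)
    = ((33 * p^4 - 22 * p\<^sup>2 * q\<^sup>2 + 5 * q^4) * q ^ 7 - (33 * q^4 - 22 * p\<^sup>2 * q\<^sup>2 + 5 * p^4) * p ^ 7) / (p * q) ^ 7"
    using p q by (simp add: diff_divide_distrib power_mult_distrib)
  also have "(33 * p^4 - 22 * p\<^sup>2 * q\<^sup>2 + 5 * q^4) * q ^ 7 - (33 * q^4 - 22 * p\<^sup>2 * q\<^sup>2 + 5 * p^4) * p ^ 7
    = (q - p) ^ 5 * (5*q^6 + 25*q^5*p + 53*q^4*p^2 + 65*q^3*p^3 + 53*q^2*p^4 + 25*q*p^5 + 5*p^6)"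
    by (simp add: algebra_simps eval_nat_numeral)
  finally show ?thesis .
qed

end

text \<open>\<open>p + q\<close> lies between \<open>2 * W\<close> and \<open>4 * W\<close>, and
  \<open>p * q\<close> between \<open>W ^ 2\<close> and \<open>4 * W ^ 2\<close>. So
  \<open>q - p\<close> can be traded for the gap \<open>q ^ 2 - p ^ 2\<close>, and the other factors
  for powers of \<open>W\<close>, at the cost of constants.\<close>

lemma homogeneous_quotient_bounds:
  fixes W p q R c1 c2 :: real
  assumes W: "0 < W" "W \<le> p" "p \<le> q" "q \<le> 2 * W"
    and R: "c1 * W ^ r \<le> R" "R \<le> c2 * W ^ r" "0 \<le> c1"
  shows "c1 / (4 ^ j * 4 ^ e) * ((q\<^sup>2 - p\<^sup>2) ^ j * W ^ r / (W ^ j * W ^ (2 * e))) \<le> (q - p) ^ j * R / (p * q) ^ e"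
    and "(q - p) ^ j * R / (p * q) ^ e \<le> c2 / 2 ^ j * ((q\<^sup>2 - p\<^sup>2) ^ j * W ^ r / (W ^ j * W ^ (2 * e)))"
proof -
  have pos: "0 < p" "0 < q" using W by auto
  have sq: "q\<^sup>2 - p\<^sup>2 = (q - p) * (p + q)" by (simp add: power2_eq_square algebra_simps)
  have d: "(q\<^sup>2 - p\<^sup>2) / (4 * W) \<le> q - p" "q - p \<le> (q\<^sup>2 - p\<^sup>2) / (2 * W)"
    unfolding sq using W mult_left_mono[of "p + q" "4 * W" "q - p"] mult_left_mono[of "2 * W" "p + q" "q - p"]
    by (simp_all add: field_simps)
  have d0: "0 \<le> q\<^sup>2 - p\<^sup>2" unfolding sq using W by simp
  have dl: "((q\<^sup>2 - p\<^sup>2) / (4 * W)) ^ j \<le> (q - p) ^ j"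
    by (rule power_mono[OF d(1)]) (use d0 W in simp)
  have du: "(q - p) ^ j \<le> ((q\<^sup>2 - p\<^sup>2) / (2 * W)) ^ j"
    by (rule power_mono[OF d(2)]) (use W in simp)
  have pq: "W ^ 2 \<le> p * q" "p * q \<le> 4 * W ^ 2"
    using mult_mono[of W p W q] mult_mono[of p "2 * W" q "2 * W"] W pos
    by (simp_all add: power2_eq_square)
  have e: "W ^ (2 * e) \<le> (p * q) ^ e" "(p * q) ^ e \<le> 4 ^ e * W ^ (2 * e)"
    using power_mono[OF pq(1), of e] power_mono[OF pq(2), of e] W pos
    by (simp_all add: power_mult power_mult_distrib)
  have R0: "0 \<le> R" using R W by (meson order_trans zero_le_mult_iff zero_le_power less_imp_le)
  have "c1 / (4 ^ j * 4 ^ e) * ((q\<^sup>2 - p\<^sup>2) ^ j * W ^ r / (W ^ j * W ^ (2 * e)))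
    = ((q\<^sup>2 - p\<^sup>2) / (4 * W)) ^ j * (c1 * W ^ r) / (4 ^ e * W ^ (2 * e))"
    by (simp add: power_divide power_mult_distrib mult_ac)
  also have "\<dots> \<le> (q - p) ^ j * R / (p * q) ^ e"
    using dl R R0 W pos e(2) d0 by (intro frac_le mult_mono) (auto intro!: mult_nonneg_nonneg)
  finally show "c1 / (4 ^ j * 4 ^ e) * ((q\<^sup>2 - p\<^sup>2) ^ j * W ^ r / (W ^ j * W ^ (2 * e))) \<le> (q - p) ^ j * R / (p * q) ^ e" .
  have "(q - p) ^ j * R / (p * q) ^ e \<le> ((q\<^sup>2 - p\<^sup>2) / (2 * W)) ^ j * (c2 * W ^ r) / W ^ (2 * e)"
    using du R W pos e(1) d0 R0 by (intro frac_le mult_mono) (auto intro!: mult_nonneg_nonneg)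
  also have "\<dots> = c2 / 2 ^ j * ((q\<^sup>2 - p\<^sup>2) ^ j * W ^ r / (W ^ j * W ^ (2 * e)))"
    by (simp add: power_divide power_mult_distrib mult_ac)
  finally show "(q - p) ^ j * R / (p * q) ^ e \<le> c2 / 2 ^ j * ((q\<^sup>2 - p\<^sup>2) ^ j * W ^ r / (W ^ j * W ^ (2 * e)))" .
qed

text \<open>Absorbs the varying constants of \<open>homogeneous_quotient_bounds\<close>, so that all
  bounds on the forms carry the same factor \<open>10 ^ 6\<close>.\<close>

lemma scale_bounds:
  fixes k K G X :: real
  assumes "0 \<le> X"
  shows "k * X \<le> G \<Longrightarrow> 0 \<le> K \<Longrightarrow> 1 \<le> K * k \<Longrightarrow> X \<le> K * G"
    and "G \<le> k * X \<Longrightarrow> k \<le> K \<Longrightarrow> G \<le> K * X"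
proof -
  assume *: "k * X \<le> G" "0 \<le> K" "1 \<le> K * k"
  have "1 * X \<le> K * k * X" using * assms by (intro mult_right_mono)
  also have "\<dots> \<le> K * G" using mult_left_mono[OF *(1,2)] by (simp add: mult.assoc)
  finally show "X \<le> K * G" by simp
next
  assume "G \<le> k * X" "k \<le> K"
  then show "G \<le> K * X" using mult_right_mono[of k K X] assms by linarith
qed

lemma monomial_bounds:
  fixes W p q :: real
  assumes "0 < W" "W \<le> p" "p \<le> q" "q \<le> 2 * W"
  shows "W ^ (i + j) \<le> q ^ i * p ^ j" "q ^ i * p ^ j \<le> 2 ^ (i + j) * W ^ (i + j)"
proof -
  show "W ^ (i + j) \<le> q ^ i * p ^ j"
    unfolding power_add using assms by (intro mult_mono power_mono) auto
  have "q ^ i * p ^ j \<le> (2 * W) ^ i * (2 * W) ^ j"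
    using assms by (intro mult_mono power_mono) auto
  then show "q ^ i * p ^ j \<le> 2 ^ (i + j) * W ^ (i + j)"
    by (simp add: power_add power_mult_distrib mult_ac)
qed

section \<open>Sizes of the forms and their derivatives on a window\<close>

context
  fixes W u v :: real
  assumes W: "0 < W" "W\<^sup>2 \<le> u" "u < v" "v \<le> 4 * W\<^sup>2"
begin

lemma sqrt_window: "W \<le> sqrt u" "sqrt u \<le> sqrt v" "sqrt v \<le> 2 * W" "0 < u" "0 < v"
    "sqrt u ^ 2 = u" "sqrt v ^ 2 = v" "sqrt u ^ 4 = u\<^sup>2" "sqrt v ^ 4 = v\<^sup>2"
proof -
  show u: "0 < u" and v: "0 < v" using W by (auto intro: less_le_trans[of 0 "W\<^sup>2"])
  show "W \<le> sqrt u" "sqrt u \<le> sqrt v" using W by (auto intro: real_le_rsqrt)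
  have "sqrt v \<le> sqrt ((2 * W)\<^sup>2)" using W by (intro real_sqrt_le_mono) (simp add: power_mult_distrib)
  then show "sqrt v \<le> 2 * W" unfolding real_sqrt_abs using W by simp
  show s: "sqrt u ^ 2 = u" "sqrt v ^ 2 = v" using u v by auto
  show "sqrt u ^ 4 = u\<^sup>2" "sqrt v ^ 4 = v\<^sup>2"
    using power_mult[of "sqrt u" 2 2] power_mult[of "sqrt v" 2 2] s by auto
qed

lemma quartic_bounds: "W ^ 4 \<le> sqrt v ^ i * sqrt u ^ j \<and> sqrt v ^ i * sqrt u ^ j \<le> 16 * W ^ 4" if "i + j = 4"
  using monomial_bounds[OF W(1) sqrt_window(1-3), of i j] that by simp

lemma sextic_bounds: "W ^ 6 \<le> sqrt v ^ i * sqrt u ^ j \<and> sqrt v ^ i * sqrt u ^ j \<le> 64 * W ^ 6" if "i + j = 6"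
  using monomial_bounds[OF W(1) sqrt_window(1-3), of i j] that by simp

lemma pade1_bounds: "(v - u) / W ^ 7 \<le> 10 ^ 6 * pade1 u v" "pade1 u v \<le> 10 ^ 6 * ((v - u) / W ^ 7)"
proof -
  let ?p = "sqrt u" and ?q = "sqrt v"
  let ?R = "?q^4 + ?q^3*?p + ?q^2*?p^2 + ?q*?p^3 + ?p^4"
  \<comment> \<open>5 is the sum of the coefficients and 80 is 16 times that sum, as every monomial
    lies between \<open>W ^ 4\<close> and \<open>16 * W ^ 4\<close>. The constants for the other
    forms arise likewise, with 64 in degree six and some rounding up.\<close>
  have R: "5 * W ^ 4 \<le> ?R" "?R \<le> 80 * W ^ 4"
    using quartic_bounds[of 4 0] quartic_bounds[of 3 1] quartic_bounds[of 2 2] quartic_bounds[of 1 3] quartic_bounds[of 0 4] by auto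
  have eq: "pade1 u v = (?q - ?p) ^ 1 * ?R / (?p * ?q) ^ 5"
    unfolding pade1_def powr_half_eq_sqrt[OF sqrt_window(4)] powr_half_eq_sqrt[OF sqrt_window(5)]
    by (rule pade1_factor) (use sqrt_window in auto)
  have sc: "(v - u) ^ 1 * W ^ 4 / (W ^ 1 * W ^ (2 * 5)) = (v - u) / W ^ 7" using W(1) by (simp add: eval_nat_numeral)
  have nn: "0 \<le> (v - u) / W ^ 7" using W by simp
  note * = homogeneous_quotient_bounds[OF W(1) sqrt_window(1-3) R, of 1 5,
      folded eq, unfolded sqrt_window(6,7) sc]
  show "(v - u) / W ^ 7 \<le> 10 ^ 6 * pade1 u v" "pade1 u v \<le> 10 ^ 6 * ((v - u) / W ^ 7)"
    by (rule scale_bounds(1)[OF nn *(1)] scale_bounds(2)[OF nn *(2)]; simp)+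
qed

lemma pade2_bounds: "(v - u) ^ 3 / W ^ 9 \<le> 10 ^ 6 * pade2 u v" "pade2 u v \<le> 10 ^ 6 * ((v - u) ^ 3 / W ^ 9)"
proof -
  let ?p = "sqrt u" and ?q = "sqrt v"
  let ?R = "3*?q^4 + 9*?q^3*?p + 11*?q^2*?p^2 + 9*?q*?p^3 + 3*?p^4"
  have R: "35 * W ^ 4 \<le> ?R" "?R \<le> 560 * W ^ 4"
    using quartic_bounds[of 4 0] quartic_bounds[of 3 1] quartic_bounds[of 2 2] quartic_bounds[of 1 3] quartic_bounds[of 0 4] by auto
  have eq: "pade2 u v = (?q - ?p) ^ 3 * ?R / (?p * ?q) ^ 5"
    unfolding pade2_def powr_half_eq_sqrt[OF sqrt_window(4)] powr_half_eq_sqrt[OF sqrt_window(5)]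
    using pade2_factor[of ?p ?q] sqrt_window by simp
  have sc: "(v - u) ^ 3 * W ^ 4 / (W ^ 3 * W ^ (2 * 5)) = (v - u) ^ 3 / W ^ 9" using W(1) by (simp add: field_simps)
  have nn: "0 \<le> (v - u) ^ 3 / W ^ 9" using W by simp
  note * = homogeneous_quotient_bounds[OF W(1) sqrt_window(1-3) R, of 3 5,
      folded eq, unfolded sqrt_window(6,7) sc]
  show "(v - u) ^ 3 / W ^ 9 \<le> 10 ^ 6 * pade2 u v" "pade2 u v \<le> 10 ^ 6 * ((v - u) ^ 3 / W ^ 9)"
    by (rule scale_bounds(1)[OF nn *(1)] scale_bounds(2)[OF nn *(2)]; simp)+
qed

lemma pade3_bounds: "0 \<le> pade3 u v" "pade3 u v \<le> 10 ^ 6 * ((v - u) ^ 5 / W ^ 11)"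
proof -
  let ?p = "sqrt u" and ?q = "sqrt v"
  let ?R = "?q^4 + 5*?q^3*?p + 9*?q^2*?p^2 + 5*?q*?p^3 + ?p^4"
  have R: "21 * W ^ 4 \<le> ?R" "?R \<le> 352 * W ^ 4"
    using W(1) quartic_bounds[of 4 0] quartic_bounds[of 3 1] quartic_bounds[of 2 2] quartic_bounds[of 1 3] quartic_bounds[of 0 4] by auto
  have eq: "pade3 u v = (?q - ?p) ^ 5 * ?R / (?p * ?q) ^ 5"
    unfolding pade3_def powr_half_eq_sqrt[OF sqrt_window(4)] powr_half_eq_sqrt[OF sqrt_window(5)]
    using pade3_factor[of ?p ?q] sqrt_window by simp
  have sc: "(v - u) ^ 5 * W ^ 4 / (W ^ 5 * W ^ (2 * 5)) = (v - u) ^ 5 / W ^ 11" using W(1) by (simp add: field_simps)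
  have nn: "0 \<le> (v - u) ^ 5 / W ^ 11" using W by simp
  note * = homogeneous_quotient_bounds[OF W(1) sqrt_window(1-3) R, of 5 5,
      folded eq, unfolded sqrt_window(6,7) sc]
  show "pade3 u v \<le> 10 ^ 6 * ((v - u) ^ 5 / W ^ 11)"
    using scale_bounds(2)[OF nn *(2), of "10 ^ 6"] by simp
  show "0 \<le> pade3 u v" by (rule order_trans[OF _ *(1)]) (use nn in simp_all)
qed

lemma pade2'_bounds: "(v - u) ^ 3 / W ^ 11 \<le> 10 ^ 6 * pade2' u v" "pade2' u v \<le> 10 ^ 6 * ((v - u) ^ 3 / W ^ 11)"
proof -
  let ?p = "sqrt u" and ?q = "sqrt v"
  let ?R = "5*?q^6 + 15*?q^5*?p + 21*?q^4*?p^2 + 23*?q^3*?p^3 + 21*?q^2*?p^4 + 15*?q*?p^5 + 5*?p^6"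
  have R: "105 * W ^ 6 \<le> ?R" "?R \<le> 6720 * W ^ 6"
    using sextic_bounds[of 6 0] sextic_bounds[of 5 1] sextic_bounds[of 4 2] sextic_bounds[of 3 3] sextic_bounds[of 2 4] sextic_bounds[of 1 5] sextic_bounds[of 0 6] by auto
  define E where "E = (9 * v - 5 * u) * v powr (-7/2) + (5 * v - 9 * u) * u powr (-7/2)"
  have pE: "pade2' u v = 3/2 * E" by (simp only: pade2'_def E_def)
  have eq: "E = (?q - ?p) ^ 3 * ?R / (?p * ?q) ^ 7"
    unfolding E_def powr_half_eq_sqrt[OF sqrt_window(4)] powr_half_eq_sqrt[OF sqrt_window(5)]
    using pade2_deriv_factor[of ?p ?q] sqrt_window by simp
  have sc: "(v - u) ^ 3 * W ^ 6 / (W ^ 3 * W ^ (2 * 7)) = (v - u) ^ 3 / W ^ 11" using W(1) by (simp add: field_simps)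
  have nn: "0 \<le> (v - u) ^ 3 / W ^ 11" using W by simp
  note * = homogeneous_quotient_bounds[OF W(1) sqrt_window(1-3) R, of 3 7,
      folded eq, unfolded sqrt_window(6,7) sc]
  show "(v - u) ^ 3 / W ^ 11 \<le> 10 ^ 6 * pade2' u v" "pade2' u v \<le> 10 ^ 6 * ((v - u) ^ 3 / W ^ 11)"
    using scale_bounds(1)[OF nn *(1), of "10 ^ 6 * (3/2)"] scale_bounds(2)[OF nn *(2), of "10 ^ 6 * (2/3)"]
    unfolding pE by simp_all
qed

lemma pade3'_bounds: "(v - u) ^ 5 / W ^ 13 \<le> 10 ^ 6 * pade3' u v"
proof -
  let ?p = "sqrt u" and ?q = "sqrt v"
  let ?R = "5*?q^6 + 25*?q^5*?p + 53*?q^4*?p^2 + 65*?q^3*?p^3 + 53*?q^2*?p^4 + 25*?q*?p^5 + 5*?p^6"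
  have R: "231 * W ^ 6 \<le> ?R" "?R \<le> 15000 * W ^ 6"
    using sextic_bounds[of 6 0] sextic_bounds[of 5 1] sextic_bounds[of 4 2] sextic_bounds[of 3 3] sextic_bounds[of 2 4] sextic_bounds[of 1 5] sextic_bounds[of 0 6] W(1) by auto
  define E where "E = (33 * u\<^sup>2 - 22 * u * v + 5 * v\<^sup>2) * u powr (-7/2)
      - (33 * v\<^sup>2 - 22 * u * v + 5 * u\<^sup>2) * v powr (-7/2)"
  have pE: "pade3' u v = 1/2 * E" by (simp only: pade3'_def E_def)
  have eq: "E = (?q - ?p) ^ 5 * ?R / (?p * ?q) ^ 7"
    unfolding E_def powr_half_eq_sqrt[OF sqrt_window(4)] powr_half_eq_sqrt[OF sqrt_window(5)]
    using pade3_deriv_factor[of ?p ?q] sqrt_window by simp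
  have sc: "(v - u) ^ 5 * W ^ 6 / (W ^ 5 * W ^ (2 * 7)) = (v - u) ^ 5 / W ^ 13" using W(1) by (simp add: field_simps)
  have nn: "0 \<le> (v - u) ^ 5 / W ^ 13" using W by simp
  note * = homogeneous_quotient_bounds[OF W(1) sqrt_window(1-3) R, of 5 7,
      folded eq, unfolded sqrt_window(6,7) sc]
  show "(v - u) ^ 5 / W ^ 13 \<le> 10 ^ 6 * pade3' u v"
    using scale_bounds(1)[OF nn *(1), of "10 ^ 6 * (1/2)"] unfolding pE by simp
qed

end

section \<open>Change of the forms at a fixed gap\<close>

lemma powr_shift:
  fixes u :: real
  assumes "u > 0"
  shows "u powr - (5/2) = u * u powr - (7/2)"
  using powr_mult_base[of u "-7/2"] assms by simp

lemma pade2_has_deriv: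
  assumes "0 < u" "0 < a"
  shows "((\<lambda>u. pade2 u (u + a)) has_real_derivative - pade2' u (u + a)) (at u)"
  unfolding pade2_def pade2'_def
  apply (rule derivative_eq_intros refl | use assms in simp; fail)+
  \<comment> \<open>Differentiation produces the exponent -7/2; \<open>powr_shift\<close> expresses
    the remaining powers -5/2 through it, which leaves a polynomial identity.\<close>
  using assms powr_shift[of u] powr_shift[of "u + a"]
  apply (simp add: powr_diff)
  apply (simp add: field_simps power2_eq_square)
  done

lemma pade3_has_deriv:
  assumes "0 < u" "0 < a"
  shows "((\<lambda>u. pade3 u (u + a)) has_real_derivative - pade3' u (u + a)) (at u)"
  unfolding pade3_def pade3'_def
  apply (rule derivative_eq_intros refl | use assms in simp; fail)+
  using assms powr_shift[of u] powr_shift[of "u + a"]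
  apply (simp add: powr_diff)
  apply (simp add: field_simps power2_eq_square)
  done

text \<open>The mean value theorem at fixed gap \<open>a\<close>: the intermediate point lies in the
  same window, where the sizes of \<open>pade2'\<close> and \<open>pade3'\<close> are known.\<close>

lemma
  fixes W u u' a :: real
  assumes W: "0 < W" "W\<^sup>2 \<le> u" "u < u'" "u' + a \<le> 4 * W\<^sup>2" "0 < a"
  shows pade2_diff_bounds:
      "(u' - u) * (a ^ 3 / W ^ 11) \<le> 10 ^ 6 * (pade2 u (u + a) - pade2 u' (u' + a))"
      "pade2 u (u + a) - pade2 u' (u' + a) \<le> 10 ^ 6 * ((u' - u) * (a ^ 3 / W ^ 11))"
    and pade3_diff_bound:
      "(u' - u) * (a ^ 5 / W ^ 13) \<le> 10 ^ 6 * (pade3 u (u + a) - pade3 u' (u' + a))"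
proof -
  have u0: "0 < u" using W by (auto intro: less_le_trans[of 0 "W\<^sup>2"])
  have "\<exists>z. u < z \<and> z < u' \<and> pade2 u' (u' + a) - pade2 u (u + a) = (u' - u) * - pade2' z (z + a)"
    by (rule MVT2) (use W u0 in \<open>auto intro!: pade2_has_deriv\<close>)
  then obtain z where z: "u < z" "z < u'" and
      eq: "pade2 u (u + a) - pade2 u' (u' + a) = (u' - u) * pade2' z (z + a)"
    by (auto simp: algebra_simps)
  have b: "a ^ 3 / W ^ 11 \<le> 10 ^ 6 * pade2' z (z + a)" "pade2' z (z + a) \<le> 10 ^ 6 * (a ^ 3 / W ^ 11)"
    using pade2'_bounds[of W z "z + a"] W z by simp_all
  show "(u' - u) * (a ^ 3 / W ^ 11) \<le> 10 ^ 6 * (pade2 u (u + a) - pade2 u' (u' + a))"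
      "pade2 u (u + a) - pade2 u' (u' + a) \<le> 10 ^ 6 * ((u' - u) * (a ^ 3 / W ^ 11))"
    using mult_left_mono[OF b(1), of "u' - u"] mult_left_mono[OF b(2), of "u' - u"] W
    unfolding eq by (simp_all add: mult_ac)
  have "\<exists>z. u < z \<and> z < u' \<and> pade3 u' (u' + a) - pade3 u (u + a) = (u' - u) * - pade3' z (z + a)"
    by (rule MVT2) (use W u0 in \<open>auto intro!: pade3_has_deriv\<close>)
  then obtain z where z: "u < z" "z < u'" and
      eq: "pade3 u (u + a) - pade3 u' (u' + a) = (u' - u) * pade3' z (z + a)"
    by (auto simp: algebra_simps)
  have b: "a ^ 5 / W ^ 13 \<le> 10 ^ 6 * pade3' z (z + a)"
    using pade3'_bounds[of W z "z + a"] W z by simp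
  show "(u' - u) * (a ^ 5 / W ^ 13) \<le> 10 ^ 6 * (pade3 u (u + a) - pade3 u' (u' + a))"
    using mult_left_mono[OF b, of "u' - u"] W unfolding eq by (simp add: mult_ac)
qed

section \<open>Points near the curve\<close>

lemma ten_powers:
  "(10 :: real) ^ 6 = 1000000" "(10 :: real) ^ 14 = 100000000000000" "(10 :: real) ^ 15 = 1000000000000000"
  by simp_all

text \<open>\<open>h1\<close> and \<open>h2\<close> say that a small main term of the order-1 or
  order-3 form is bounded by the approximation error. These conclusions are impossible: for
  \<open>h1\<close> because \<open>W ^ 2 \<le> Z ^ 6\<close>, for \<open>h2\<close> as long as
  \<open>W ^ 6\<close> is below about \<open>Z ^ 17\<close>. So the main terms are not small;
  \<open>h2\<close> is used for moderate \<open>W\<close> and \<open>h1\<close> for large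
  \<open>W\<close>.\<close>

lemma gap_lower_bounds:
  fixes Z W a :: real
  assumes Z: "10 ^ 100 \<le> Z" and W: "0 < W" "W\<^sup>2 \<le> Z ^ 6" and a: "1 \<le> a"
    and h1: "2 * 10 ^ 6 * (Z ^ 18 * a) < W ^ 7 \<Longrightarrow> Z ^ 17 * a \<le> 2 * 10 ^ 6 * W\<^sup>2"
    and h2: "2 * 10 ^ 6 * (Z ^ 18 * a ^ 3) < W ^ 9 \<Longrightarrow> Z ^ 17 * a ^ 3 \<le> 28 * 10 ^ 6 * W ^ 6"
  shows "W \<le> 2 * 10 ^ 6 * (Z\<^sup>2 * a)" "6 * 10 ^ 7 * W ^ 8 < Z ^ 17 * a ^ 4"
proof -
  have Z_ge_1: "1 \<le> Z" "0 < Z" using Z by simp_all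
  have Zp: "10 ^ 100 * Z ^ n \<le> Z ^ Suc n" for n using Z Z_ge_1 by simp
  have "W \<le> 2 * 10 ^ 6 * (Z\<^sup>2 * a) \<and> 6 * 10 ^ 7 * W ^ 8 < Z ^ 17 * a ^ 4"
  proof (cases "W \<le> Z\<^sup>2")
    \<comment> \<open>Here \<open>a \<ge> 1\<close> already suffices, with a spare factor
      \<open>Z\<close> absorbing the constants.\<close>
    case True
    have "Z\<^sup>2 \<le> Z\<^sup>2 * a" using mult_left_mono[OF a, of "Z\<^sup>2"] by simp
    moreover have "0 \<le> Z\<^sup>2" by simp
    ultimately have 1: "W \<le> 2 * 10 ^ 6 * (Z\<^sup>2 * a)" using True unfolding ten_powers by linarith
    have "W ^ 8 \<le> (Z\<^sup>2) ^ 8" using True W by (intro power_mono) auto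
    then have "W ^ 8 \<le> Z ^ 16" by (simp flip: power_mult)
    moreover have "Z ^ 17 * 1 \<le> Z ^ 17 * a ^ 4" using a Z_ge_1 by (intro mult_left_mono) auto
    moreover have "6 * 10 ^ 7 * Z ^ 16 < 10 ^ 100 * Z ^ 16" using Z_ge_1 by simp
    moreover have "6 * 10 ^ 7 * W ^ 8 \<le> 6 * 10 ^ 7 * Z ^ 16" using calculation(1) by simp
    moreover have "10 ^ 100 * Z ^ 16 \<le> Z ^ 17" using Zp[of 16] by simp
    ultimately have "6 * 10 ^ 7 * W ^ 8 < Z ^ 17 * a ^ 4" by linarith
    with 1 show ?thesis by blast
  next
    case False
    have W2: "Z ^ 4 \<le> W\<^sup>2"
      using False power_mono[of "Z\<^sup>2" W 2] Z_ge_1 by (simp flip: power_mult)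
    show ?thesis
    proof (cases "3 * 10 ^ 7 * W ^ 6 \<le> Z ^ 17")
      case True
      have "W ^ 9 \<le> 2 * 10 ^ 6 * (Z ^ 18 * a ^ 3)"
      proof (rule ccontr)
        assume "\<not> ?thesis"
        then have "Z ^ 17 * a ^ 3 \<le> 28 * 10 ^ 6 * W ^ 6" by (intro h2) simp
        moreover have "Z ^ 17 * 1 \<le> Z ^ 17 * a ^ 3" using a Z_ge_1 by (intro mult_left_mono) auto
        moreover have "28 * 10 ^ 6 * W ^ 6 < 3 * 10 ^ 7 * W ^ 6" using W by simp
        ultimately show False using True by linarith
      qed
      \<comment> \<open>\<open>2 * 10 ^ 6\<close> is enlarged to the cube \<open>200 ^ 3\<close> so
        that a cube root can be taken.\<close>
      also have "\<dots> \<le> 200 ^ 3 * (Z ^ 18 * a ^ 3)" using a Z_ge_1 by simp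
      finally have "(W ^ 3) ^ 3 \<le> (200 * (Z ^ 6 * a)) ^ 3"
        by (simp add: power_mult_distrib flip: power_mult)
      then have W3: "W ^ 3 \<le> 200 * (Z ^ 6 * a)"
        by (rule power_le_imp_le_base[of _ 2, simplified]) (use a Z_ge_1 in simp)
      have "Z ^ 4 * W \<le> W ^ 3" using mult_right_mono[OF W2, of W] W by (simp add: eval_nat_numeral)
      also have "\<dots> \<le> Z ^ 4 * (200 * (Z\<^sup>2 * a))" using W3 by (simp add: eval_nat_numeral)
      finally have "W \<le> 200 * (Z\<^sup>2 * a)" using Z_ge_1 by (simp only: mult_le_cancel_left_pos zero_less_power)
      moreover have "200 * (Z\<^sup>2 * a) \<le> 2 * 10 ^ 6 * (Z\<^sup>2 * a)" using a Z_ge_1 by (intro mult_right_mono) auto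
      ultimately have 1: "W \<le> 2 * 10 ^ 6 * (Z\<^sup>2 * a)" by (rule order_trans)
      have "(W ^ 3) ^ 4 \<le> (200 * (Z ^ 6 * a)) ^ 4" by (rule power_mono[OF W3]) (use W in simp)
      then have "W ^ 12 \<le> 200 ^ 4 * (Z ^ 24 * a ^ 4)" by (simp add: power_mult_distrib flip: power_mult)
      then have "W ^ 8 * W ^ 4 \<le> Z ^ 7 * (200 ^ 4 * (Z ^ 17 * a ^ 4))"
        by (simp add: eval_nat_numeral)
      moreover have "W ^ 8 * Z ^ 8 \<le> W ^ 8 * W ^ 4"
        using power_mono[OF W2, of 2] W Z_ge_1 by (intro mult_left_mono) (simp_all flip: power_mult)
      moreover have "W ^ 8 * (10 ^ 100 * Z ^ 7) \<le> W ^ 8 * Z ^ 8"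
        using Zp[of 7] W by (intro mult_left_mono) simp_all
      ultimately have "Z ^ 7 * (10 ^ 100 * W ^ 8) \<le> Z ^ 7 * (200 ^ 4 * (Z ^ 17 * a ^ 4))"
        by (simp only: mult_ac)
      then have "10 ^ 100 * W ^ 8 \<le> 200 ^ 4 * (Z ^ 17 * a ^ 4)"
        using Z_ge_1 by (simp only: mult_le_cancel_left_pos zero_less_power)
      moreover have "200 ^ 4 * (6 * 10 ^ 7 * W ^ 8) < 10 ^ 100 * W ^ 8" using W by simp
      ultimately have "200 ^ 4 * (6 * 10 ^ 7 * W ^ 8) < 200 ^ 4 * (Z ^ 17 * a ^ 4)" by linarith
      then have "6 * 10 ^ 7 * W ^ 8 < Z ^ 17 * a ^ 4" by (simp add: mult.commute[of "Z ^ 17"])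
      with 1 show ?thesis by blast
    next
      case False
      have "3 * 10 ^ 7 * Z ^ 16 \<le> 10 ^ 100 * Z ^ 16" using Z_ge_1 by simp
      also have "\<dots> \<le> Z ^ 17" using Zp[of 16] by simp
      also have "\<dots> \<le> 3 * 10 ^ 7 * W ^ 6" using False by simp
      finally have W6: "Z ^ 16 \<le> W ^ 6" by simp
      have "W ^ 7 \<le> 2 * 10 ^ 6 * (Z ^ 18 * a)"
      proof (rule ccontr)
        assume "\<not> ?thesis"
        then have "Z ^ 17 * a \<le> 2 * 10 ^ 6 * W\<^sup>2" by (intro h1) simp
        moreover have "Z ^ 17 * 1 \<le> Z ^ 17 * a" using a Z_ge_1 by (intro mult_left_mono) auto
        moreover have "10 ^ 100 * Z ^ 16 \<le> Z ^ 17" using Zp[of 16] by simp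
        moreover have "Z ^ 6 \<le> Z ^ 16" using Z_ge_1 by (intro power_increasing) auto
        moreover have "2 * 10 ^ 6 * Z ^ 16 < 10 ^ 100 * Z ^ 16" using Z_ge_1 by simp
        moreover have "2 * 10 ^ 6 * W\<^sup>2 \<le> 2 * 10 ^ 6 * Z ^ 16" using W(2) calculation(4) by simp
        ultimately show False by linarith
      qed
      note W7 = this
      have "Z ^ 16 * W \<le> W ^ 7" using mult_right_mono[OF W6, of W] W by (simp add: eval_nat_numeral)
      also have "\<dots> \<le> Z ^ 16 * (2 * 10 ^ 6 * (Z\<^sup>2 * a))" using W7 by (simp add: eval_nat_numeral)
      finally have 1: "W \<le> 2 * 10 ^ 6 * (Z\<^sup>2 * a)"
        using Z_ge_1 by (simp only: mult_le_cancel_left_pos zero_less_power)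
      have "Z ^ 15 \<le> Z ^ 16" using Z_ge_1 by (intro power_increasing) auto
      then have "(Z ^ 5) ^ 3 \<le> (W\<^sup>2) ^ 3" using W6 by (simp flip: power_mult)
      then have W5: "Z ^ 5 \<le> W\<^sup>2" by (rule power_le_imp_le_base[of _ 2, simplified]) (use W in simp)
      \<comment> \<open>The aim is to split \<open>W ^ 28 = W ^ 20 * W ^ 8\<close>. With
        \<open>W ^ 20\<close> at least of order \<open>Z ^ 56\<close> and \<open>W ^ 28\<close> at
        most of order \<open>Z ^ 72 * a ^ 4\<close>, what remains for \<open>W ^ 8\<close> is order
        \<open>Z ^ 16 * a ^ 4\<close>; the spare factor \<open>Z\<close> absorbs the
        constants.\<close>
      have "(Z ^ 17) ^ 3 \<le> (3 * 10 ^ 7 * W ^ 6) ^ 3" using False Z_ge_1 by (intro power_mono) auto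
      then have "Z ^ 51 \<le> (3 * 10 ^ 7) ^ 3 * W ^ 18" by (simp add: power_mult_distrib flip: power_mult)
      then have "Z ^ 51 * Z ^ 5 \<le> (3 * 10 ^ 7) ^ 3 * W ^ 18 * W\<^sup>2"
        using W5 W Z_ge_1 by (intro mult_mono) auto
      then have W20: "Z ^ 56 \<le> (3 * 10 ^ 7) ^ 3 * W ^ 20" by (simp add: mult.assoc flip: power_add)
      have "(W ^ 7) ^ 4 \<le> (2 * 10 ^ 6 * (Z ^ 18 * a)) ^ 4" by (rule power_mono[OF W7]) (use W in simp)
      then have "W ^ 28 \<le> (2 * 10 ^ 6) ^ 4 * (Z ^ 72 * a ^ 4)"
        by (simp add: power_mult_distrib flip: power_mult)
      note W28 = this
      have "Z ^ 55 * (10 ^ 100 * W ^ 8) = W ^ 8 * (10 ^ 100 * Z ^ 55)" by (simp only: mult_ac)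
      also have "\<dots> \<le> W ^ 8 * Z ^ 56" using Zp[of 55] W by (intro mult_left_mono) simp_all
      also have "\<dots> \<le> W ^ 8 * ((3 * 10 ^ 7) ^ 3 * W ^ 20)" using W20 W by (intro mult_left_mono) simp_all
      also have "\<dots> = (3 * 10 ^ 7) ^ 3 * W ^ 28"
        by (simp add: mult.left_commute[of "W ^ 8"] flip: power_add)
      also have "\<dots> \<le> (3 * 10 ^ 7) ^ 3 * ((2 * 10 ^ 6) ^ 4 * (Z ^ 72 * a ^ 4))"
        by (rule mult_left_mono[OF W28]) simp
      also have "Z ^ 72 = Z ^ 55 * Z ^ 17" by (simp flip: power_add)
      also have "(3 * 10 ^ 7) ^ 3 * ((2 * 10 ^ 6) ^ 4 * (Z ^ 55 * Z ^ 17 * a ^ 4))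
          = Z ^ 55 * ((3 * 10 ^ 7) ^ 3 * ((2 * 10 ^ 6) ^ 4 * (Z ^ 17 * a ^ 4)))"
        by (simp only: mult_ac)
      finally have "Z ^ 55 * (10 ^ 100 * W ^ 8) \<le> Z ^ 55 * ((3 * 10 ^ 7) ^ 3 * ((2 * 10 ^ 6) ^ 4 * (Z ^ 17 * a ^ 4)))" .
      then have "10 ^ 100 * W ^ 8 \<le> (3 * 10 ^ 7) ^ 3 * ((2 * 10 ^ 6) ^ 4 * (Z ^ 17 * a ^ 4))"
        using Z_ge_1 by (simp only: mult_le_cancel_left_pos zero_less_power)
      moreover have "(3 * 10 ^ 7) ^ 3 * ((2 * 10 ^ 6) ^ 4 * (6 * 10 ^ 7 * W ^ 8)) < 10 ^ 100 * W ^ 8"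
        using W by simp
      ultimately have "(3 * 10 ^ 7) ^ 3 * ((2 * 10 ^ 6) ^ 4 * (6 * 10 ^ 7 * W ^ 8))
          < (3 * 10 ^ 7) ^ 3 * ((2 * 10 ^ 6) ^ 4 * (Z ^ 17 * a ^ 4))" by linarith
      then have "6 * 10 ^ 7 * W ^ 8 < Z ^ 17 * a ^ 4" by (simp add: mult.commute[of "Z ^ 17"])
      with 1 show ?thesis by blast
    qed
  qed
  then show "W \<le> 2 * 10 ^ 6 * (Z\<^sup>2 * a)" "6 * 10 ^ 7 * W ^ 8 < Z ^ 17 * a ^ 4" by auto
qed

text \<open>
  The two entries of the minimum bound the size of a cluster by spacing and by the number of values of the
  order-3 form; neither alone suffices in the whole range of \<open>W\<close>.
\<close>

lemma product_term_bound:
  fixes Z W a :: real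
  assumes "0 < Z" "0 < W" "0 < a" "a * Z ^ 3 \<le> W\<^sup>2"
  shows "a ^ 5 * Z ^ 18 / W ^ 11 * min (W ^ 12 / (Z ^ 17 * a ^ 6)) (Z * W / a\<^sup>2) \<le> Z ^ 6 / W\<^sup>2"
proof (cases "W ^ 3 \<le> a * Z ^ 5")
  case True
  have "a ^ 5 * Z ^ 18 / W ^ 11 * min (W ^ 12 / (Z ^ 17 * a ^ 6)) (Z * W / a\<^sup>2)
    \<le> a ^ 5 * Z ^ 18 / W ^ 11 * (W ^ 12 / (Z ^ 17 * a ^ 6))"
    using assms by (intro mult_left_mono) auto
  also have "\<dots> = Z * W / a" using assms by (simp add: field_simps eval_nat_numeral)
  also have "\<dots> \<le> Z ^ 6 / W\<^sup>2"
    using mult_left_mono[OF True, of Z] assms by (simp add: field_simps eval_nat_numeral)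
  finally show ?thesis .
next
  case False
  \<comment> \<open>This makes the second entry of the minimum small enough. For
    \<open>W \<le> Z ^ 2\<close> it follows by cubing the negated case condition, otherwise by
    cubing the hypothesis on \<open>a * Z ^ 3\<close>.\<close>
  have "a ^ 3 * Z ^ 13 \<le> W ^ 8"
  proof (cases "W \<le> Z\<^sup>2")
    case True
    have "(a * Z ^ 5) ^ 3 \<le> (W ^ 3) ^ 3" using False assms by (intro power_mono) auto
    also have "\<dots> = W ^ 8 * W" by (simp add: eval_nat_numeral)
    also have "\<dots> \<le> W ^ 8 * Z\<^sup>2" using True assms by (intro mult_left_mono) auto
    finally have "(a ^ 3 * Z ^ 13) * Z\<^sup>2 \<le> W ^ 8 * Z\<^sup>2" by (simp add: eval_nat_numeral mult_ac)
    then show ?thesis using assms by (simp only: mult_le_cancel_right_pos zero_less_power)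
  next
    case False
    have "(a * Z ^ 3) ^ 3 * (Z\<^sup>2)\<^sup>2 \<le> (W\<^sup>2) ^ 3 * W\<^sup>2"
      using False assms by (intro mult_mono power_mono) auto
    then show ?thesis by (simp add: eval_nat_numeral mult_ac)
  qed
  note * = this
  have "a ^ 5 * Z ^ 18 / W ^ 11 * min (W ^ 12 / (Z ^ 17 * a ^ 6)) (Z * W / a\<^sup>2)
    \<le> a ^ 5 * Z ^ 18 / W ^ 11 * (Z * W / a\<^sup>2)"
    using assms by (intro mult_left_mono) auto
  also have "\<dots> = a ^ 3 * Z ^ 13 * (Z ^ 6 / W ^ 10)" using assms by (simp add: field_simps eval_nat_numeral)
  also have "\<dots> \<le> W ^ 8 * (Z ^ 6 / W ^ 10)" using * assms by (intro mult_right_mono) auto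
  also have "\<dots> = Z ^ 6 / W\<^sup>2" using assms by (simp add: field_simps eval_nat_numeral)
  finally show ?thesis .
qed

lemma combination_error:
  fixes A B M X Y e1 e2 d :: real
  assumes "\<bar>e1 - X\<bar> \<le> d" "\<bar>e2 - Y\<bar> \<le> d" "\<bar>A\<bar> \<le> M" "\<bar>B\<bar> \<le> M"
  shows "\<bar>(A * e1 + B * e2) - (A * X + B * Y)\<bar> \<le> 2 * M * d"
proof -
  have "\<bar>(A * e1 + B * e2) - (A * X + B * Y)\<bar> = \<bar>A * (e1 - X) + B * (e2 - Y)\<bar>"
    by (simp add: algebra_simps)
  also have "\<dots> \<le> \<bar>A\<bar> * \<bar>e1 - X\<bar> + \<bar>B\<bar> * \<bar>e2 - Y\<bar>"
    by (metis abs_mult abs_triangle_ineq)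
  also have "\<dots> \<le> M * d + M * d" using assms by (intro add_mono mult_mono) auto
  finally show ?thesis by simp
qed

lemma small_integer:
  fixes i :: int and g e :: real
  assumes "\<bar>real_of_int i - g\<bar> \<le> e" "\<bar>g\<bar> < 1/2" "e < 1/2"
  shows "\<bar>g\<bar> \<le> e"
proof -
  have "\<bar>real_of_int i\<bar> < 1" using assms by linarith
  then have "i = 0" by linarith
  then show ?thesis using assms by simp
qed

text \<open>
  The points \<open>(b, m b)\<close> are integer points close to the curve \<open>Z ^ 18 / b powr (5/2)\<close>, with \<open>b\<close> in a
  dyadic range around \<open>W\<^sup>2\<close>. For \<open>x = Z ^ 36\<close> they come from \<open>(m b)\<^sup>2 * b ^ 5\<close> lying just above \<open>x\<close>;
  in these units every exponent that occurs is an integer.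
\<close>

locale near_curve =
  fixes Z W :: real and S :: "nat set" and m :: "nat \<Rightarrow> int"
  assumes Z: "10 ^ 100 \<le> Z" and W: "0 < W" "Z ^ 3 \<le> W\<^sup>2" "W\<^sup>2 \<le> Z ^ 6"
    and S: "\<And>b. b \<in> S \<Longrightarrow> W\<^sup>2 \<le> real b \<and> real b \<le> 2 * W\<^sup>2"
    and m: "\<And>b. b \<in> S \<Longrightarrow> \<bar>real_of_int (m b) - Z ^ 18 * real b powr (-5/2)\<bar> \<le> Z / W ^ 5"
begin

text \<open>\<open>form1\<close>, \<open>form2\<close> and \<open>form3\<close> are the counterparts
  of \<open>pade1\<close>, \<open>pade2\<close> and \<open>pade3\<close> with \<open>m u\<close> in
  place of \<open>Z ^ 18 * u powr (-5/2)\<close>; as the Pade coefficients are integers, so are the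
  values.\<close>

definition form1 :: "nat \<Rightarrow> nat \<Rightarrow> int" where
  "form1 a u = m u - m (u + a)"

definition form2 :: "nat \<Rightarrow> nat \<Rightarrow> int" where
  "form2 a u = (7 * int (u + a) - 3 * int u) * m (u + a) + (3 * int (u + a) - 7 * int u) * m u"

definition form3 :: "nat \<Rightarrow> nat \<Rightarrow> int" where
  "form3 a u = (21 * (int u)\<^sup>2 - 6 * int u * int (u + a) + (int (u + a))\<^sup>2) * m u
    - (21 * (int (u + a))\<^sup>2 - 6 * int u * int (u + a) + (int u)\<^sup>2) * m (u + a)"

lemma Z_ge_1: "1 \<le> Z" "0 < Z"
  using Z by simp_all

lemma finite_S: "finite S"
  by (rule finite_subset[of _ "{..nat \<lfloor>2 * W\<^sup>2\<rfloor>}"]) (auto dest: S simp: le_nat_floor)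

lemma W_large: "10 ^ 50 * Z \<le> W" "1 \<le> W"
proof -
  have "(10 ^ 50 * Z)\<^sup>2 = 10 ^ 100 * Z\<^sup>2" by (simp add: power_mult_distrib)
  also have "\<dots> \<le> Z * Z\<^sup>2" using Z by (intro mult_right_mono) auto
  also have "\<dots> \<le> W\<^sup>2" using W(2) by (simp add: eval_nat_numeral)
  finally show "10 ^ 50 * Z \<le> W" by (rule power2_le_imp_le) (use W in simp)
  then show "1 \<le> W" using Z_ge_1 by simp
qed

lemma error_small: "n \<ge> 1 \<Longrightarrow> Z / W ^ n \<le> 1 / 1000"
proof -
  assume "n \<ge> 1"
  then have "W ^ 1 \<le> W ^ n" using W_large by (intro power_increasing) auto
  then have "Z / W ^ n \<le> Z / W" using W(1) Z_ge_1 by (intro divide_left_mono) auto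
  also have "\<dots> \<le> 1 / 1000" using W_large(1) W(1) Z_ge_1 by (simp add: field_simps)
  finally show ?thesis .
qed

section \<open>Approximation of the forms and exclusion of short gaps\<close>

context
  fixes a u :: nat
  assumes a: "1 \<le> a" and u: "u \<in> S" "u + a \<in> S"
begin

lemma window: "W\<^sup>2 \<le> real u" "real u < real u + real a" "real u + real a \<le> 2 * W\<^sup>2"
    "real u + real a \<le> 4 * W\<^sup>2" "0 \<le> W\<^sup>2"
  using S[OF u(1)] S[OF u(2)] a by auto

lemma form1_approx: "\<bar>real_of_int (form1 a u) - Z ^ 18 * pade1 (real u) (real u + real a)\<bar> \<le> 2 * (Z / W ^ 5)"
  using combination_error[OF m[OF u(1)] m[OF u(2)], of 1 1 "- 1"]
  by (simp add: form1_def pade1_def algebra_simps)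

text \<open>The coefficients are of order \<open>W ^ 2\<close> and raise the error
  \<open>Z / W ^ 5\<close> of \<open>m\<close> to order \<open>Z / W ^ 3\<close>. For
  \<open>form3\<close> they are of order \<open>W ^ 4\<close>, which leads to
  \<open>Z / W\<close>.\<close>

lemma form2_approx: "\<bar>real_of_int (form2 a u) - Z ^ 18 * pade2 (real u) (real u + real a)\<bar> \<le> 28 * (Z / W ^ 3)"
proof -
  have "\<bar>3 * (real u + real a) - 7 * real u\<bar> \<le> 14 * W\<^sup>2" "\<bar>7 * (real u + real a) - 3 * real u\<bar> \<le> 14 * W\<^sup>2"
    using window unfolding abs_le_iff by auto
  from combination_error[OF m[OF u(1)] m[OF u(2)] this]
  have "\<bar>real_of_int (form2 a u) - Z ^ 18 * pade2 (real u) (real u + real a)\<bar> \<le> 2 * (14 * W\<^sup>2) * (Z / W ^ 5)"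
    by (simp add: form2_def pade2_def algebra_simps)
  also have "\<dots> = 28 * (Z / W ^ 3)" using W(1) by (simp add: field_simps eval_nat_numeral)
  finally show ?thesis .
qed

lemma form3_approx: "\<bar>real_of_int (form3 a u) - Z ^ 18 * pade3 (real u) (real u + real a)\<bar> \<le> 224 * (Z / W)"
proof -
  define v where "v = real u + real a"
  have sq: "0 \<le> s * t \<and> s * t \<le> 4 * W ^ 4" if "0 \<le> s" "s \<le> 2 * W\<^sup>2" "0 \<le> t" "t \<le> 2 * W\<^sup>2" for s t
    using mult_mono[OF that(2,4)] that window by (simp add: eval_nat_numeral)
  have "0 \<le> real u" "real u \<le> 2 * W\<^sup>2" "0 \<le> v" "v \<le> 2 * W\<^sup>2" using window by (auto simp: v_def)
  then have sqs: "0 \<le> (real u)\<^sup>2" "(real u)\<^sup>2 \<le> 4 * W ^ 4" "0 \<le> v\<^sup>2" "v\<^sup>2 \<le> 4 * W ^ 4"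
      "0 \<le> real u * v" "real u * v \<le> 4 * W ^ 4"
    using sq[of "real u" "real u"] sq[of v v] sq[of "real u" v]
    by (simp_all add: power2_eq_square[of "real u"] power2_eq_square[of v])
  have "\<bar>21 * (real u)\<^sup>2 - 6 * (real u * v) + v\<^sup>2\<bar> \<le> 112 * W ^ 4"
      "\<bar>- (21 * v\<^sup>2 - 6 * (real u * v) + (real u)\<^sup>2)\<bar> \<le> 112 * W ^ 4"
    unfolding abs_le_iff by (intro conjI; use sqs in linarith)+
  from combination_error[OF m[OF u(1)] m[OF u(2)] this]
  have "\<bar>real_of_int (form3 a u) - Z ^ 18 * pade3 (real u) v\<bar> \<le> 2 * (112 * W ^ 4) * (Z / W ^ 5)"
    by (simp add: form3_def pade3_def v_def algebra_simps)
  also have "\<dots> = 224 * (Z / W)" using W(1) by (simp add: field_simps eval_nat_numeral)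
  finally show ?thesis by (simp add: v_def)
qed

text \<open>
  An integer that is approximated by a positive quantity below \<open>1/2\<close> vanishes, so the quantity is no larger
  than the approximation error. For short gaps this contradicts the lower bounds on \<open>pade1\<close> or \<open>pade2\<close>.
\<close>

lemma gap_bounds:
  "W \<le> 2 * 10 ^ 6 * (Z\<^sup>2 * real a)" "6 * 10 ^ 7 * W ^ 8 < Z ^ 17 * real a ^ 4"
proof -
  have h1: "Z ^ 17 * real a \<le> 2 * 10 ^ 6 * W\<^sup>2" if small: "2 * 10 ^ 6 * (Z ^ 18 * real a) < W ^ 7"
  proof -
    define G where "G = Z ^ 18 * pade1 (real u) (real u + real a)"
    define X where "X = Z ^ 18 * (real a / W ^ 7)"
    note b = pade1_bounds[OF W(1) window(1,2,4), simplified add_diff_cancel_left']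
    have G: "X \<le> 10 ^ 6 * G" "G \<le> 10 ^ 6 * X"
      using mult_left_mono[OF b(1), of "Z ^ 18"] mult_left_mono[OF b(2), of "Z ^ 18"] Z_ge_1
      by (simp_all add: G_def X_def mult_ac)
    have X: "0 \<le> X" "2 * 10 ^ 6 * X < 1" using Z_ge_1 W(1) small by (simp_all add: X_def field_simps)
    have "\<bar>G\<bar> \<le> 2 * (Z / W ^ 5)"
    proof (rule small_integer[OF form1_approx[folded G_def]])
      show "\<bar>G\<bar> < 1/2" using G X by (simp add: abs_less_iff)
      have "Z / W ^ 5 \<le> 1 / 1000" by (rule error_small) simp
      then show "2 * (Z / W ^ 5) < 1/2" by linarith
    qed
    then have "X \<le> 2 * 10 ^ 6 * (Z / W ^ 5)" using G unfolding ten_powers by linarith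
    then have "Z * (Z ^ 17 * real a) \<le> Z * (2 * 10 ^ 6 * W\<^sup>2)"
      using W(1) Z_ge_1 by (simp add: X_def field_simps eval_nat_numeral)
    then show ?thesis using Z_ge_1 by (simp only: mult_le_cancel_left_pos)
  qed
  have h2: "Z ^ 17 * real a ^ 3 \<le> 28 * 10 ^ 6 * W ^ 6" if small: "2 * 10 ^ 6 * (Z ^ 18 * real a ^ 3) < W ^ 9"
  proof -
    define G where "G = Z ^ 18 * pade2 (real u) (real u + real a)"
    define X where "X = Z ^ 18 * (real a ^ 3 / W ^ 9)"
    note b = pade2_bounds[OF W(1) window(1,2,4), simplified add_diff_cancel_left']
    have G: "X \<le> 10 ^ 6 * G" "G \<le> 10 ^ 6 * X"
      using mult_left_mono[OF b(1), of "Z ^ 18"] mult_left_mono[OF b(2), of "Z ^ 18"] Z_ge_1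
      by (simp_all add: G_def X_def mult_ac)
    have X: "0 \<le> X" "2 * 10 ^ 6 * X < 1" using Z_ge_1 W(1) small by (simp_all add: X_def field_simps)
    have "\<bar>G\<bar> \<le> 28 * (Z / W ^ 3)"
    proof (rule small_integer[OF form2_approx[folded G_def]])
      show "\<bar>G\<bar> < 1/2" using G X by (simp add: abs_less_iff)
      have "Z / W ^ 3 \<le> 1 / 1000" by (rule error_small) simp
      then show "28 * (Z / W ^ 3) < 1/2" by linarith
    qed
    then have "X \<le> 28 * 10 ^ 6 * (Z / W ^ 3)" using G unfolding ten_powers by linarith
    then have "Z * (Z ^ 17 * real a ^ 3) \<le> Z * (28 * 10 ^ 6 * W ^ 6)"
      using W(1) Z_ge_1 by (simp add: X_def field_simps eval_nat_numeral)
    then show ?thesis using Z_ge_1 by (simp only: mult_le_cancel_left_pos)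
  qed
  show "W \<le> 2 * 10 ^ 6 * (Z\<^sup>2 * real a)" "6 * 10 ^ 7 * W ^ 8 < Z ^ 17 * real a ^ 4"
    using gap_lower_bounds[OF Z W(1,3) _ h1 h2] a by simp_all
qed

end

section \<open>Points with a fixed gap to their successor\<close>

context
  fixes a :: nat
  assumes a: "1 \<le> a"
begin

abbreviation "T \<equiv> gap_starts S a"

text \<open>Up to a constant, the error \<open>Z / W\<close> of \<open>form3\<close> divided by the
  slope \<open>Z ^ 18 * a ^ 5 / W ^ 13\<close> of its main term.\<close>

definition cluster_diam :: real where "cluster_diam = 5 * 10 ^ 8 * (W ^ 12 / (Z ^ 17 * real a ^ 5))"

lemma gap_starts_mem: "u \<in> T \<Longrightarrow> u \<in> S \<and> u + a \<in> S"
  by (simp add: gap_starts_def)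

lemma gap_starts_spaced: "u \<in> T \<Longrightarrow> w \<in> T \<Longrightarrow> u < w \<Longrightarrow> real a \<le> real w - real u"
  by (force simp: gap_starts_def)

lemma gap_starts_pade_diff:
  assumes "u \<in> T" "w \<in> T" "u < w"
  shows "(real w - real u) * (real a ^ 3 / W ^ 11)
      \<le> 10 ^ 6 * (pade2 (real u) (real u + real a) - pade2 (real w) (real w + real a))"
    and "pade2 (real u) (real u + real a) - pade2 (real w) (real w + real a)
      \<le> 10 ^ 6 * ((real w - real u) * (real a ^ 3 / W ^ 11))"
    and "(real w - real u) * (real a ^ 5 / W ^ 13)
      \<le> 10 ^ 6 * (pade3 (real u) (real u + real a) - pade3 (real w) (real w + real a))"
proof -
  have "W\<^sup>2 \<le> real u" "real u < real w" "real w + real a \<le> 4 * W\<^sup>2" "0 < real a"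
    using assms gap_starts_mem window(1,4) a by auto
  note b = pade2_diff_bounds[OF W(1) this] pade3_diff_bound[OF W(1) this]
  show "(real w - real u) * (real a ^ 3 / W ^ 11)
      \<le> 10 ^ 6 * (pade2 (real u) (real u + real a) - pade2 (real w) (real w + real a))"
    "pade2 (real u) (real u + real a) - pade2 (real w) (real w + real a)
      \<le> 10 ^ 6 * ((real w - real u) * (real a ^ 3 / W ^ 11))"
    "(real w - real u) * (real a ^ 5 / W ^ 13)
      \<le> 10 ^ 6 * (pade3 (real u) (real u + real a) - pade3 (real w) (real w + real a))"
    using b by simp_all
qed

text \<open>Equal values leave the main terms at most twice the error apart, that is
  \<open>448 * (Z / W)\<close>, while their difference grows at least linearly with the
  distance.\<close>

lemma same_form3_close:
  assumes "u \<in> T" "w \<in> T" "u < w" and eq: "form3 a u = form3 a w"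
  shows "real w - real u \<le> cluster_diam"
proof -
  define D where "D = pade3 (real u) (real u + real a) - pade3 (real w) (real w + real a)"
  have "\<bar>real_of_int (form3 a u) - Z ^ 18 * pade3 (real u) (real u + real a)\<bar> \<le> 224 * (Z / W)"
      "\<bar>real_of_int (form3 a w) - Z ^ 18 * pade3 (real w) (real w + real a)\<bar> \<le> 224 * (Z / W)"
    using form3_approx[OF a] gap_starts_mem assms(1,2) by auto
  then have "Z ^ 18 * D \<le> 448 * (Z / W)"
    using eq unfolding D_def right_diff_distrib abs_le_iff by simp
  moreover have "Z ^ 18 * ((real w - real u) * (real a ^ 5 / W ^ 13)) \<le> Z ^ 18 * (10 ^ 6 * D)"
    using gap_starts_pade_diff(3)[OF assms(1-3)] Z_ge_1 unfolding D_def by (intro mult_left_mono) auto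
  ultimately have "Z ^ 18 * ((real w - real u) * (real a ^ 5 / W ^ 13)) \<le> 448 * 10 ^ 6 * (Z / W)"
    unfolding ten_powers by linarith
  moreover define d where "d = real w - real u"
  ultimately have "Z ^ 18 * (d * (real a ^ 5 / W ^ 13)) \<le> 448 * 10 ^ 6 * (Z / W)" by simp
  then have "Z * (Z ^ 17 * real a ^ 5 * d) \<le> Z * (448 * 10 ^ 6 * W ^ 12)"
    using W(1) Z_ge_1 by (simp add: field_simps eval_nat_numeral)
  then have "Z ^ 17 * real a ^ 5 * d \<le> 448 * 10 ^ 6 * W ^ 12"
    using Z_ge_1 by (simp only: mult_le_cancel_left_pos)
  also have "\<dots> \<le> 5 * 10 ^ 8 * W ^ 12" using W(1) by simp
  finally show ?thesis using a Z_ge_1 by (simp add: cluster_diam_def field_simps flip: d_def)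
qed

text \<open>Starting points are at least \<open>a\<close> apart, so a collision would push
  \<open>a\<close> times the slope \<open>Z ^ 18 * a ^ 3 / W ^ 11\<close> down to the size of the
  error. The second part of \<open>gap_bounds\<close> is tailored to exclude this: its
  \<open>6 * 10 ^ 7\<close> exceeds \<open>56 * 10 ^ 6\<close>.\<close>

lemma form2_injective:
  assumes "u \<in> T" "w \<in> T" "u < w"
  shows "form2 a u \<noteq> form2 a w"
proof
  assume eq: "form2 a u = form2 a w"
  define D where "D = pade2 (real u) (real u + real a) - pade2 (real w) (real w + real a)"
  have "\<bar>real_of_int (form2 a u) - Z ^ 18 * pade2 (real u) (real u + real a)\<bar> \<le> 28 * (Z / W ^ 3)"
      "\<bar>real_of_int (form2 a w) - Z ^ 18 * pade2 (real w) (real w + real a)\<bar> \<le> 28 * (Z / W ^ 3)"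
    using form2_approx[OF a] gap_starts_mem assms(1,2) by auto
  then have "Z ^ 18 * D \<le> 56 * (Z / W ^ 3)"
    using eq unfolding D_def right_diff_distrib abs_le_iff by simp
  moreover have "Z ^ 18 * ((real w - real u) * (real a ^ 3 / W ^ 11)) \<le> Z ^ 18 * (10 ^ 6 * D)"
    using gap_starts_pade_diff(1)[OF assms(1-3)] Z_ge_1 unfolding D_def by (intro mult_left_mono) auto
  moreover have "Z ^ 18 * (real a * (real a ^ 3 / W ^ 11)) \<le> Z ^ 18 * ((real w - real u) * (real a ^ 3 / W ^ 11))"
    using gap_starts_spaced[OF assms] Z_ge_1 W(1) by (intro mult_left_mono mult_right_mono) auto
  ultimately have "Z ^ 18 * (real a * (real a ^ 3 / W ^ 11)) \<le> 56 * 10 ^ 6 * (Z / W ^ 3)"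
    unfolding ten_powers by linarith
  then have "Z * (Z ^ 17 * real a ^ 4) \<le> Z * (56 * 10 ^ 6 * W ^ 8)"
    using W(1) Z_ge_1 by (simp add: field_simps eval_nat_numeral)
  then have "Z ^ 17 * real a ^ 4 \<le> 56 * 10 ^ 6 * W ^ 8"
    using Z_ge_1 by (simp only: mult_le_cancel_left_pos)
  also have "\<dots> \<le> 6 * 10 ^ 7 * W ^ 8" using W(1) by simp
  also have "\<dots> < Z ^ 17 * real a ^ 4" using gap_bounds(2)[OF a, of u] gap_starts_mem[OF assms(1)] by blast
  finally show False by simp
qed

text \<open>The slope of the main term times the cluster diameter has order
  \<open>Z * W / a ^ 2\<close>; the summand 1 covers the two approximation errors.\<close>

lemma form2_close:
  assumes "u \<in> T" "w \<in> T" "u < w" and d: "real w - real u \<le> cluster_diam"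
  shows "\<bar>real_of_int (form2 a u) - real_of_int (form2 a w)\<bar> \<le> 5 * 10 ^ 14 * (Z * W / (real a)\<^sup>2) + 1"
proof -
  define D where "D = pade2 (real u) (real u + real a) - pade2 (real w) (real w + real a)"
  have D: "(real w - real u) * (real a ^ 3 / W ^ 11) \<le> 10 ^ 6 * D" "D \<le> 10 ^ 6 * ((real w - real u) * (real a ^ 3 / W ^ 11))"
    using gap_starts_pade_diff(1,2)[OF assms(1-3)] by (auto simp: D_def)
  have "0 \<le> (real w - real u) * (real a ^ 3 / W ^ 11)" using assms W(1) by simp
  then have D0: "0 \<le> D" using D by simp
  have "D \<le> 10 ^ 6 * (cluster_diam * (real a ^ 3 / W ^ 11))"
    by (rule order_trans[OF D(2)]) (use d W(1) in \<open>intro mult_left_mono mult_right_mono; simp\<close>)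
  then have "Z ^ 18 * D \<le> Z ^ 18 * (10 ^ 6 * (cluster_diam * (real a ^ 3 / W ^ 11)))"
    using Z_ge_1 by (intro mult_left_mono) auto
  also have "\<dots> = 5 * 10 ^ 14 * (Z * W / (real a)\<^sup>2)"
    using a Z_ge_1 W(1) by (simp add: cluster_diam_def field_simps eval_nat_numeral)
  finally have *: "Z ^ 18 * D \<le> 5 * 10 ^ 14 * (Z * W / (real a)\<^sup>2)" .
  have "0 \<le> Z ^ 18 * D" using D0 Z_ge_1 by simp
  moreover have "Z / W ^ 3 \<le> 1 / 1000" by (rule error_small) simp
  moreover have "\<bar>real_of_int (form2 a u) - Z ^ 18 * pade2 (real u) (real u + real a)\<bar> \<le> 28 * (Z / W ^ 3)"
      "\<bar>real_of_int (form2 a w) - Z ^ 18 * pade2 (real w) (real w + real a)\<bar> \<le> 28 * (Z / W ^ 3)"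
    using form2_approx[OF a] gap_starts_mem assms(1,2) by auto
  ultimately show ?thesis using * unfolding D_def right_diff_distrib by linarith
qed

lemma finite_gap_starts: "finite T"
  using finite_S by (simp add: gap_starts_def)

lemma cluster_diam_nonneg: "0 \<le> cluster_diam"
  using W(1) Z_ge_1 by (simp add: cluster_diam_def)

text \<open>A fibre is a cluster that can be counted in two ways: by its spacing \<open>a\<close>
  within \<open>cluster_diam\<close>, and by the values of \<open>form2\<close>, which is injective
  and varies little on it.\<close>

lemma card_form3_fiber_le:
  "real (card {u \<in> T. form3 a u = c})
    \<le> 3 + 10 ^ 15 * min (W ^ 12 / (Z ^ 17 * real a ^ 6)) (Z * W / (real a)\<^sup>2)"
proof -
  define F where "F = {u \<in> T. form3 a u = c}"
  have F: "u \<in> T" "form3 a u = c" if "u \<in> F" for u using that by (auto simp: F_def)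
  have finF: "finite F" using finite_gap_starts by (simp add: F_def)
  have close: "real w - real u \<le> cluster_diam" if "u \<in> F" "w \<in> F" "u < w" for u w
    using same_form3_close that F by metis
  have "real (card F) \<le> cluster_diam / real a + 1"
    by (rule card_spaced[OF finF _ cluster_diam_nonneg]) (use a gap_starts_spaced F close in auto)
  moreover have "cluster_diam / real a = 5 * 10 ^ 8 * (W ^ 12 / (Z ^ 17 * real a ^ 6))"
    using a by (simp add: cluster_diam_def field_simps eval_nat_numeral)
  moreover have "5 * 10 ^ 8 * (W ^ 12 / (Z ^ 17 * real a ^ 6)) \<le> 10 ^ 15 * (W ^ 12 / (Z ^ 17 * real a ^ 6))"
    using W(1) Z_ge_1 by (intro mult_right_mono) auto
  ultimately have 1: "real (card F) \<le> 3 + 10 ^ 15 * (W ^ 12 / (Z ^ 17 * real a ^ 6))" by linarith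
  have q0: "0 \<le> Z * W / (real a)\<^sup>2" using W(1) Z_ge_1 by simp
  have 2: "real (card F) \<le> 3 + 10 ^ 15 * (Z * W / (real a)\<^sup>2)"
  proof (cases "F = {}")
    case False
    then obtain u0 where u0: "u0 \<in> F" by blast
    define L where "L = 5 * 10 ^ 14 * (Z * W / (real a)\<^sup>2) + 1"
    have "inj_on (form2 a) F"
    proof (rule linorder_inj_onI)
      fix x y assume "x \<in> F" "y \<in> F" "x < y"
      then show "form2 a x \<noteq> form2 a y" using form2_injective F by blast
    qed auto
    then have "card F = card (form2 a ` F)" by (simp add: card_image)
    \<comment> \<open>Values may lie on either side of the one at \<open>u0\<close>, hence the
      length \<open>2 * L\<close>. Doubling \<open>L\<close> and adding 1 gives the constants
      \<open>10 ^ 15\<close> and 3.\<close>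
    moreover have "real (card (form2 a ` F)) \<le> 2 * L + 1"
    proof (rule card_ints_in_interval)
      show "0 \<le> 2 * L" using q0 by (simp add: L_def)
      fix i assume "i \<in> form2 a ` F"
      then obtain u where u: "u \<in> F" "i = form2 a u" by blast
      have "\<bar>real_of_int (form2 a u) - real_of_int (form2 a u0)\<bar> \<le> L"
      proof (cases u u0 rule: linorder_cases)
        case less
        then show ?thesis using form2_close[OF F(1)[OF u(1)] F(1)[OF u0] less close[OF u(1) u0 less]] by (simp add: L_def)
      next
        case equal
        then show ?thesis using q0 by (simp add: L_def)
      next
        case greater
        then show ?thesis using form2_close[OF F(1)[OF u0] F(1)[OF u(1)] greater close[OF u0 u(1) greater]]
          by (simp add: L_def abs_minus_commute)
      qed
      then show "real_of_int (form2 a u0) - L \<le> real_of_int i \<and> real_of_int i \<le> real_of_int (form2 a u0) - L + 2 * L"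
        using u by linarith
    qed
    ultimately show ?thesis by (simp add: L_def)
  qed (use q0 in simp)
  show ?thesis using 1 2 unfolding F_def by (simp add: min_def)
qed

text \<open>The number of values of \<open>form3\<close> times the size of a fibre, multiplied out;
  \<open>product_term_bound\<close> controls the product of the two main terms.\<close>

lemma card_gap_starts_le:
  assumes A: "real a * Z ^ 3 \<le> W\<^sup>2"
  shows "real (card T) \<le> 6 + 3 * 10 ^ 6 * (real a ^ 5 * Z ^ 18 / W ^ 11)
    + 10 ^ 21 * (Z ^ 6 / W\<^sup>2) + 2 * 10 ^ 15 * (Z * W / (real a)\<^sup>2)"
proof -
  define M where "M = real a ^ 5 * Z ^ 18 / W ^ 11"
  define \<mu> where "\<mu> = min (W ^ 12 / (Z ^ 17 * real a ^ 6)) (Z * W / (real a)\<^sup>2)"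
  have M0: "0 \<le> M" using Z_ge_1 W(1) by (simp add: M_def)
  have \<mu>0: "0 \<le> \<mu>" using Z_ge_1 W(1) by (simp add: \<mu>_def)
  \<comment> \<open>Errors of at most 1/2 at both ends lengthen the range from 0 to
    \<open>10 ^ 6 * M\<close> by 1; the other 1 comes from counting integers in an interval.\<close>
  have "real (card (form3 a ` T)) \<le> (10 ^ 6 * M + 1) + 1"
  proof (rule card_ints_in_interval)
    show "0 \<le> 10 ^ 6 * M + 1" using M0 by simp
    fix i assume "i \<in> form3 a ` T"
    then obtain u where u: "u \<in> T" "i = form3 a u" by blast
    note uS = gap_starts_mem[OF u(1), THEN conjunct1] gap_starts_mem[OF u(1), THEN conjunct2]
    note b = pade3_bounds[OF W(1) window(1,2,4)[OF a uS], simplified add_diff_cancel_left']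
    have "0 \<le> Z ^ 18 * pade3 (real u) (real u + real a)" using b Z_ge_1 by simp
    moreover have "Z ^ 18 * pade3 (real u) (real u + real a) \<le> 10 ^ 6 * M"
      using mult_left_mono[OF b(2), of "Z ^ 18"] Z_ge_1 by (simp add: M_def mult_ac)
    moreover have "224 * (Z / W) \<le> 1/2" using error_small[of 1] by simp
    ultimately show "- (1/2) \<le> real_of_int i \<and> real_of_int i \<le> - (1/2) + (10 ^ 6 * M + 1)"
      using form3_approx[OF a uS] unfolding u(2) abs_le_iff by linarith
  qed
  then have c: "real (card (form3 a ` T)) \<le> 10 ^ 6 * M + 2" by simp
  have "real (card T) \<le> real (card (form3 a ` T)) * (3 + 10 ^ 15 * \<mu>)"
    by (rule card_le_card_image_times[OF finite_gap_starts card_form3_fiber_le[folded \<mu>_def]])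
  also have "\<dots> \<le> (10 ^ 6 * M + 2) * (3 + 10 ^ 15 * \<mu>)"
    using c \<mu>0 by (intro mult_right_mono) auto
  also have "\<dots> = 6 + 3 * 10 ^ 6 * M + 10 ^ 21 * (M * \<mu>) + 2 * 10 ^ 15 * \<mu>"
    by (simp add: algebra_simps)
  also have "M * \<mu> \<le> Z ^ 6 / W\<^sup>2"
    unfolding M_def \<mu>_def by (rule product_term_bound) (use Z_ge_1 W a A in auto)
  also have "\<mu> \<le> Z * W / (real a)\<^sup>2" by (simp add: \<mu>_def)
  finally show ?thesis by (simp add: M_def)
qed

end

text \<open>\<open>A\<close> is chosen so that large gaps account for about
  \<open>W ^ 2 / A = Z ^ 3\<close> points. Summed over the smaller gaps, the contributions are of
  order \<open>A\<close>, \<open>W\<close>, \<open>Z ^ 3\<close> and, from the inverse squares,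
  again \<open>Z ^ 3\<close>; none exceeds the order \<open>Z ^ 3\<close>.\<close>

lemma card_S_le: "real (card S) \<le> 10 ^ 30 * Z ^ 3"
proof -
  define A where "A = W\<^sup>2 / Z ^ 3"
  define J where "J = {a :: nat. 1 \<le> a \<and> real a \<le> A}"
  have Z3: "1 \<le> Z ^ 3" "0 < Z ^ 3" using Z_ge_1 by simp_all
  have A: "0 < A" "A \<le> Z ^ 3" "A * Z ^ 3 = W\<^sup>2"
    using W Z_ge_1 by (simp_all add: A_def field_simps flip: power_add)
  have finJ: "finite J"
    by (rule finite_subset[of _ "{..nat \<lfloor>A\<rfloor>}"]) (auto simp: J_def le_nat_floor)
  have "J \<subseteq> {1..nat \<lfloor>A\<rfloor>}" by (auto simp: J_def le_nat_floor)
  then have "card J \<le> nat \<lfloor>A\<rfloor>" using card_mono[of "{1..nat \<lfloor>A\<rfloor>}" J] by simp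
  then have cJ: "real (card J) \<le> A" using A(1) by linarith
  \<comment> \<open>Only gaps that occur are summed. By \<open>gap_bounds\<close> they are at least
    of order \<open>W / Z ^ 2\<close>, and this keeps the sum of inverse squares of order
    \<open>Z ^ 2 / W\<close>.\<close>
  define J' where "J' = {a \<in> J. gap_starts S a \<noteq> {}}"
  have J'J: "J' \<subseteq> J" by (auto simp: J'_def)
  have finJ': "finite J'" using finJ J'J finite_subset by blast
  have cJ': "real (card J') \<le> A" using cJ card_mono[OF finJ J'J] by simp
  have J'D: "1 \<le> a" "real a \<le> A" if "a \<in> J'" for a using that by (auto simp: J'_def J_def)
  have J'r: "W / (2 * 10 ^ 6 * Z\<^sup>2) \<le> real a" if "a \<in> J'" for a
  proof -
    obtain u where "u \<in> gap_starts S a" using \<open>a \<in> J'\<close> by (auto simp: J'_def)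
    then have "W \<le> 2 * 10 ^ 6 * (Z\<^sup>2 * real a)"
      using gap_bounds(1)[of a u] J'D[OF \<open>a \<in> J'\<close>] by (auto simp: gap_starts_def)
    then show ?thesis using Z_ge_1 by (simp add: field_simps)
  qed
  have "real (card S) \<le> W\<^sup>2 / A + 1 + (\<Sum>a\<in>J. real (card (gap_starts S a)))"
    unfolding J_def
  proof (rule card_le_sum_gap_starts[OF finite_S A(1)])
    fix u w assume "u \<in> S" "w \<in> S"
    then show "real w - real u \<le> W\<^sup>2" using S[of u] S[of w] by linarith
  qed simp
  also have "W\<^sup>2 / A = Z ^ 3" using W(1) Z_ge_1 by (simp add: A_def)
  also have "(\<Sum>a\<in>J. real (card (gap_starts S a))) = (\<Sum>a\<in>J'. real (card (gap_starts S a)))"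
    by (rule sum.mono_neutral_right) (use finJ in \<open>auto simp: J'_def\<close>)
  also have "\<dots> \<le> (\<Sum>a\<in>J'. 6 + 3 * 10 ^ 6 * (A ^ 5 * Z ^ 18 / W ^ 11)
    + 10 ^ 21 * (Z ^ 6 / W\<^sup>2) + 2 * 10 ^ 15 * (Z * W) * (1 / (real a)\<^sup>2))"
  proof (rule sum_mono)
    fix a assume a: "a \<in> J'"
    have "real a * Z ^ 3 \<le> A * Z ^ 3" using J'D[OF a] Z_ge_1 by (intro mult_right_mono) auto
    then have "real (card (gap_starts S a)) \<le> 6 + 3 * 10 ^ 6 * (real a ^ 5 * Z ^ 18 / W ^ 11)
        + 10 ^ 21 * (Z ^ 6 / W\<^sup>2) + 2 * 10 ^ 15 * (Z * W / (real a)\<^sup>2)"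
      using card_gap_starts_le J'D[OF a] A(3) by simp
    moreover have "real a ^ 5 * Z ^ 18 / W ^ 11 \<le> A ^ 5 * Z ^ 18 / W ^ 11"
      using J'D[OF a] Z_ge_1 W(1) by (intro divide_right_mono mult_right_mono power_mono) auto
    ultimately show "real (card (gap_starts S a)) \<le> 6 + 3 * 10 ^ 6 * (A ^ 5 * Z ^ 18 / W ^ 11)
      + 10 ^ 21 * (Z ^ 6 / W\<^sup>2) + 2 * 10 ^ 15 * (Z * W) * (1 / (real a)\<^sup>2)"
      by simp
  qed
  also have "\<dots> = real (card J') * (6 + 3 * 10 ^ 6 * (A ^ 5 * Z ^ 18 / W ^ 11) + 10 ^ 21 * (Z ^ 6 / W\<^sup>2))
      + 2 * 10 ^ 15 * (Z * W) * (\<Sum>a\<in>J'. 1 / (real a)\<^sup>2)"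
    by (simp only: sum.distrib sum_constant sum_distrib_left distrib_left)
  also have "\<dots> \<le> A * (6 + 3 * 10 ^ 6 * (A ^ 5 * Z ^ 18 / W ^ 11) + 10 ^ 21 * (Z ^ 6 / W\<^sup>2))
      + 2 * 10 ^ 15 * (Z * W) * (2 / (W / (2 * 10 ^ 6 * Z\<^sup>2)))"
  proof (intro add_mono mult_right_mono mult_left_mono)
    show "(\<Sum>a\<in>J'. 1 / (real a)\<^sup>2) \<le> 2 / (W / (2 * 10 ^ 6 * Z\<^sup>2))"
      by (rule sum_inverse_squares_le[OF finJ']) (use W(1) Z_ge_1 J'D J'r in auto)
  qed (use cJ' W(1) Z_ge_1 A in auto)
  also have "\<dots> = 6 * A + 3 * 10 ^ 6 * (A * (A ^ 5 * Z ^ 18 / W ^ 11)) + 10 ^ 21 * (A * (Z ^ 6 / W\<^sup>2))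
      + 8 * 10 ^ 21 * Z ^ 3"
    using W(1) Z_ge_1 by (simp add: algebra_simps eval_nat_numeral)
  also have "A * (A ^ 5 * Z ^ 18 / W ^ 11) = W"
    using W(1) Z_ge_1 by (simp add: A_def field_simps eval_nat_numeral)
  also have "A * (Z ^ 6 / W\<^sup>2) = Z ^ 3"
    using W(1) Z_ge_1 by (simp add: A_def field_simps eval_nat_numeral)
  finally have "real (card S) \<le> Z ^ 3 + 1 + (6 * A + 3 * 10 ^ 6 * W + 10 ^ 21 * Z ^ 3 + 8 * 10 ^ 21 * Z ^ 3)"
    by simp
  moreover have "W \<le> Z ^ 3"
  proof (rule power2_le_imp_le)
    show "W\<^sup>2 \<le> (Z ^ 3)\<^sup>2" using W(3) by (simp flip: power_mult)
  qed (use Z_ge_1 in simp)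
  ultimately show ?thesis using A(2) Z3 by simp
qed

end

section \<open>Integers of the form a^2 b^5 in short intervals\<close>

lemma powr_neg_bound:
  assumes "0 < w" "w\<^sup>2 \<le> real b"
  shows "real b powr (-5/2) \<le> 1 / w ^ 5"
proof -
  have b: "0 < real b" using assms by (meson less_le_trans zero_less_power)
  have "w \<le> sqrt (real b)" using assms by (simp add: real_le_rsqrt)
  then have "1 / sqrt (real b) ^ 5 \<le> 1 / w ^ 5" using assms b by (intro divide_left_mono power_mono) auto
  then show ?thesis using powr_half_eq_sqrt(1)[OF b] by simp
qed

definition represented :: "real \<Rightarrow> real \<Rightarrow> nat set" where
  "represented x y = {n. x < real n \<and> real n \<le> x + y \<and> (\<exists>a b. n = a ^ 2 * b ^ 5)}"

lemma finite_nats_between: "finite {n. x < real n \<and> real n \<le> z}"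
  by (rule finite_subset[of _ "{..nat \<lfloor>z\<rfloor>}"]) (auto simp: le_nat_floor)

lemma finite_represented: "finite (represented x y)"
  by (rule finite_subset[OF _ finite_nats_between[of x "x + y"]]) (auto simp: represented_def)

lemma abs_sum_le_card_represented:
  assumes "0 \<le> x"
  shows "\<bar>real_of_int (\<Sum>n | x < real n \<and> real n \<le> x + y. lambda5_conv_one n)\<bar>
    \<le> real (card (represented x y))"
proof -
  let ?I = "{n. x < real n \<and> real n \<le> x + y}"
  have "\<bar>\<Sum>n\<in>?I. lambda5_conv_one n\<bar> \<le> (\<Sum>n\<in>?I. \<bar>lambda5_conv_one n\<bar>)" by (rule sum_abs)
  also have "\<dots> \<le> (\<Sum>n\<in>?I. if n \<in> represented x y then 1 else 0)"
  proof (rule sum_mono)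
    fix n assume n: "n \<in> ?I"
    then have "0 < n" using assms by (cases n) auto
    then show "\<bar>lambda5_conv_one n\<bar> \<le> (if n \<in> represented x y then 1 else 0)"
      using lambda5_conv_one_support[of n] n by (auto simp: represented_def)
  qed
  also have "\<dots> = int (card (?I \<inter> represented x y))"
    using finite_nats_between[of x "x + y"] by (simp add: sum.If_cases)
  also have "?I \<inter> represented x y = represented x y" by (auto simp: represented_def)
  finally show ?thesis by linarith
qed

section \<open>The count for \<open>x = Z ^ 36\<close> and \<open>y\<close> at most
  \<open>Z ^ 19\<close>\<close>

context
  fixes Z y :: real
  assumes Z: "10 ^ 100 \<le> Z" and y: "0 \<le> y" "y \<le> Z ^ 19"
begin

definition square_bases :: "nat \<Rightarrow> nat set" where
  "square_bases b = {a. Z ^ 36 < real (a ^ 2 * b ^ 5) \<and> real (a ^ 2 * b ^ 5) \<le> Z ^ 36 + y}"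

lemma Z_ge_1: "1 \<le> Z" "0 < Z"
  using Z by simp_all

lemma target_le: "Z ^ 36 + y \<le> 2 * Z ^ 36"
  using y(2) power_increasing[of 19 36 Z] Z_ge_1 by simp

lemma square_bases_pos: "a \<in> square_bases b \<Longrightarrow> 1 \<le> a \<and> 1 \<le> b"
  using Z_ge_1 by (cases "a = 0 \<or> b = 0") (auto simp: square_bases_def not_less)

text \<open>With \<open>\<beta> = b powr (5/2)\<close>, the square of \<open>a * \<beta>\<close>
  exceeds that of \<open>Z ^ 18\<close> by at most \<open>Z ^ 19\<close>. Dividing the difference of
  squares by \<open>Z ^ 18\<close> leaves a width of \<open>Z\<close>, which matches the error
  allowed in \<open>near_curve\<close>.\<close>

lemma square_bases_window:
  assumes "a \<in> square_bases b"
  shows "Z ^ 18 * real b powr (-5/2) \<le> real a" "real a \<le> Z ^ 18 * real b powr (-5/2) + Z * real b powr (-5/2)"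
proof -
  have b: "0 < real b" using square_bases_pos[OF assms] by simp
  define \<beta> where "\<beta> = real b powr (5/2)"
  have "\<beta>\<^sup>2 = real b powr (5/2 + 5/2)" by (simp only: \<beta>_def power2_eq_square powr_add)
  then have \<beta>: "0 < \<beta>" "\<beta>\<^sup>2 = real b ^ 5"
    using b powr_realpow[OF b, of 5] by (simp_all add: \<beta>_def)
  have inv: "real b powr (-5/2) = 1 / \<beta>" using b by (simp add: \<beta>_def powr_minus_divide)
  have sq: "(Z ^ 18)\<^sup>2 \<le> (real a * \<beta>)\<^sup>2" "(real a * \<beta>)\<^sup>2 \<le> (Z ^ 18)\<^sup>2 + Z ^ 19"
    using assms y \<beta>(2) by (auto simp: square_bases_def power_mult_distrib simp flip: power_mult)
  have lo: "Z ^ 18 \<le> real a * \<beta>"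
    using sq(1) by (rule power2_le_imp_le) (use \<beta> in simp)
  have "(real a * \<beta> - Z ^ 18) * Z ^ 18 \<le> (real a * \<beta> - Z ^ 18) * (real a * \<beta> + Z ^ 18)"
    using lo \<beta> by (intro mult_left_mono) auto
  also have "\<dots> \<le> Z * Z ^ 18"
    using sq(2) by (simp add: power2_eq_square algebra_simps flip: power_Suc)
  finally have hi: "real a * \<beta> - Z ^ 18 \<le> Z" using Z_ge_1 by (simp only: mult_le_cancel_right_pos zero_less_power)
  show "Z ^ 18 * real b powr (-5/2) \<le> real a" "real a \<le> Z ^ 18 * real b powr (-5/2) + Z * real b powr (-5/2)"
    unfolding inv using lo hi \<beta>(1) by (simp_all add: field_simps)
qed

lemma finite_square_bases: "finite (square_bases b)"
proof (cases "b = 0")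
  case True
  then show ?thesis using square_bases_pos[of _ b] by (metis all_not_in_conv finite.emptyI not_one_le_zero)
next
  case False
  have "a \<in> square_bases b \<Longrightarrow> real a \<le> Z ^ 36 + y" for a
  proof -
    assume a: "a \<in> square_bases b"
    have "a * 1 \<le> a ^ 2 * b ^ 5"
      using square_bases_pos[OF a] by (intro mult_mono) (auto simp: power2_eq_square)
    then have "real a \<le> real (a ^ 2 * b ^ 5)" by (intro of_nat_mono) simp
    moreover have "real (a ^ 2 * b ^ 5) \<le> Z ^ 36 + y" using a by (simp only: square_bases_def mem_Collect_eq)
    ultimately show ?thesis by (rule order_trans)
  qed
  then show ?thesis
    by (intro finite_subset[OF _ finite_atMost[of "nat \<lfloor>Z ^ 36 + y\<rfloor>"]]) (auto simp: le_nat_floor)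
qed

lemma card_square_bases_le:
  assumes "0 < w" "w\<^sup>2 \<le> real b"
  shows "real (card (square_bases b)) \<le> Z / w ^ 5 + 1"
proof -
  have "real (card (square_bases b)) \<le> (Z / w ^ 5) / 1 + 1"
  proof (rule card_spaced[OF finite_square_bases])
    fix a a' assume "a \<in> square_bases b" "a' \<in> square_bases b"
    then have "real a' - real a \<le> Z * real b powr (-5/2)" using square_bases_window[of a b] square_bases_window[of a' b] by linarith
    also have "\<dots> \<le> Z * (1 / w ^ 5)" using powr_neg_bound[OF assms] Z_ge_1 by (intro mult_left_mono) auto
    finally show "real a' - real a \<le> Z / w ^ 5" by simp
  qed (use Z_ge_1 assms in auto)
  then show ?thesis by simp
qed

text \<open>The window for \<open>a\<close> is then shorter than 1, so counting represented numbers
  reduces to counting \<open>b\<close>.\<close>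

lemma card_square_bases_le_1:
  assumes "Z\<^sup>2 \<le> real b"
  shows "card (square_bases b) \<le> 1"
proof -
  have "Z / Z ^ 5 < 1" using Z_ge_1 Z by (simp add: divide_simps) (simp add: power_strict_increasing[of 1 5 Z, simplified])
  then have "real (card (square_bases b)) < 2" using card_square_bases_le[OF Z_ge_1(2) assms] by linarith
  then show ?thesis by linarith
qed

text \<open>An instance of \<open>near_curve\<close> with \<open>W = sqrt D\<close>; for each
  \<open>b\<close> an arbitrary admissible \<open>a\<close> serves as the integer near the
  curve.\<close>

lemma card_block:
  fixes D :: real
  assumes D: "Z ^ 3 \<le> D" "D \<le> Z ^ 6"
  shows "real (card {b. D \<le> real b \<and> real b \<le> 2 * D \<and> square_bases b \<noteq> {}}) \<le> 10 ^ 30 * Z ^ 3"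
proof -
  have D0: "0 < D" using D(1) Z_ge_1 zero_less_power[of Z 3] by linarith
  define m where "m b = int (SOME a. a \<in> square_bases b)" for b
  interpret near_curve Z "sqrt D" "{b. D \<le> real b \<and> real b \<le> 2 * D \<and> square_bases b \<noteq> {}}" m
  proof
    fix b assume b: "b \<in> {b. D \<le> real b \<and> real b \<le> 2 * D \<and> square_bases b \<noteq> {}}"
    then show "(sqrt D)\<^sup>2 \<le> real b \<and> real b \<le> 2 * (sqrt D)\<^sup>2" using D0 by simp
    define a where "a = (SOME a. a \<in> square_bases b)"
    have a: "a \<in> square_bases b" "m b = int a" using b by (auto simp: a_def m_def some_in_eq)
    have "Z * real b powr (-5/2) \<le> Z * (1 / sqrt D ^ 5)"
      using powr_neg_bound[of "sqrt D" b] b D0 Z_ge_1 by (intro mult_left_mono) auto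
    then show "\<bar>real_of_int (m b) - Z ^ 18 * real b powr (-5/2)\<bar> \<le> Z / sqrt D ^ 5"
      using square_bases_window[OF a(1)] a(2) by simp
  qed (use Z D D0 in auto)
  show ?thesis by (rule card_S_le)
qed

text \<open>Dyadic blocks starting at \<open>2 ^ j * Z ^ 3\<close>; their number, of order
  \<open>ln Z\<close>, is the source of the logarithm in the final bounds.\<close>

lemma card_mid:
  "real (card {b. Z ^ 3 \<le> real b \<and> real b \<le> Z ^ 6 \<and> square_bases b \<noteq> {}}) \<le> 7 * ln Z * (10 ^ 30 * Z ^ 3)"
proof -
  define J where "J = {j :: nat. 2 ^ j \<le> Z ^ 3}"
  define E where "E j = {b. 2 ^ j * Z ^ 3 \<le> real b \<and> real b \<le> 2 * (2 ^ j * Z ^ 3) \<and> square_bases b \<noteq> {}}" for j :: nat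
  have finE: "finite (E j)" for j
    by (rule finite_subset[of _ "{..nat \<lfloor>2 * (2 ^ j * Z ^ 3)\<rfloor>}"]) (auto simp: E_def le_nat_floor)
  have lnZ: "1 \<le> ln Z"
  proof -
    have "exp 1 \<le> Z" using e_less_272 Z by simp
    then show ?thesis using Z_ge_1 by (simp add: ln_ge_iff)
  qed
  have J: "real j \<le> 6 * ln Z" if "j \<in> J" for j
  proof -
    have "ln ((2 :: real) ^ j) \<le> ln (Z ^ 3)" using that Z_ge_1 by (simp add: J_def)
    then have "real j * ln 2 \<le> 3 * ln Z" using Z_ge_1 by (simp add: ln_realpow)
    moreover have "real j * (1/2) \<le> real j * ln 2" using ln2_ge_two_thirds by (intro mult_left_mono) auto
    ultimately show ?thesis by linarith
  qed
  have JJ: "J \<subseteq> {..nat \<lfloor>6 * ln Z\<rfloor>}" using J by (auto simp: le_nat_floor)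
  then have finJ: "finite J" using finite_subset by blast
  \<comment> \<open>The index \<open>j = 0\<close> adds 1, absorbed by \<open>1 \<le> ln Z\<close>;
    this turns 6 into 7.\<close>
  have "card J \<le> nat \<lfloor>6 * ln Z\<rfloor> + 1" using card_mono[OF _ JJ] by simp
  then have cJ: "real (card J) \<le> 7 * ln Z" using lnZ by linarith
  have "{b. Z ^ 3 \<le> real b \<and> real b \<le> Z ^ 6 \<and> square_bases b \<noteq> {}} \<subseteq> (\<Union>j\<in>J. E j)"
  proof
    fix b assume b: "b \<in> {b. Z ^ 3 \<le> real b \<and> real b \<le> Z ^ 6 \<and> square_bases b \<noteq> {}}"
    have Z3: "0 < Z ^ 3" using Z_ge_1 by simp
    define r where "r = real b / Z ^ 3"
    have r: "1 \<le> r" "r \<le> Z ^ 3" using b Z3 by (auto simp: r_def field_simps simp flip: power_add)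
    define j where "j = nat \<lfloor>log 2 r\<rfloor>"
    have lg: "0 \<le> log 2 r" using r by simp
    have "real j \<le> log 2 r" "log 2 r \<le> real j + 1" using lg unfolding j_def by linarith+
    then have "2 powr real j \<le> r" "r \<le> 2 powr (real j + 1)" using r by (simp_all add: le_log_iff log_le_iff)
    then have "2 ^ j \<le> r" "r \<le> 2 * 2 ^ j" by (simp_all add: powr_add powr_realpow mult.commute)
    then have "2 ^ j \<le> Z ^ 3" "2 ^ j * Z ^ 3 \<le> real b" "real b \<le> 2 * (2 ^ j * Z ^ 3)"
      using r(2) Z3 by (linarith, simp_all add: r_def field_simps)
    then have "j \<in> J" "b \<in> E j" using b by (auto simp: J_def E_def)
    then show "b \<in> (\<Union>j\<in>J. E j)" by blast
  qed
  then have "card {b. Z ^ 3 \<le> real b \<and> real b \<le> Z ^ 6 \<and> square_bases b \<noteq> {}} \<le> card (\<Union>j\<in>J. E j)"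
    using finJ finE by (intro card_mono) auto
  also have "\<dots> \<le> (\<Sum>j\<in>J. card (E j))" by (rule card_UN_le[OF finJ])
  finally have "real (card {b. Z ^ 3 \<le> real b \<and> real b \<le> Z ^ 6 \<and> square_bases b \<noteq> {}}) \<le> (\<Sum>j\<in>J. real (card (E j)))"
    by (simp flip: of_nat_sum)
  also have "\<dots> \<le> (\<Sum>j\<in>J. 10 ^ 30 * Z ^ 3)"
  proof (rule sum_mono)
    fix j assume "j \<in> J"
    then have "2 ^ j * Z ^ 3 \<le> Z ^ 3 * Z ^ 3" using Z_ge_1 by (intro mult_right_mono) (auto simp: J_def)
    moreover have "1 * Z ^ 3 \<le> 2 ^ j * Z ^ 3" using Z_ge_1 by (intro mult_right_mono) auto
    ultimately show "real (card (E j)) \<le> 10 ^ 30 * Z ^ 3"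
      unfolding E_def by (intro card_block) (simp_all flip: power_add)
  qed
  also have "\<dots> \<le> 7 * ln Z * (10 ^ 30 * Z ^ 3)"
    using mult_right_mono[OF cJ, of "10 ^ 30 * Z ^ 3"] Z_ge_1 by simp
  finally show ?thesis .
qed

text \<open>For large \<open>b\<close> the roles are exchanged: now \<open>a\<close> is small and determines \<open>b\<close>.\<close>

definition fifth_bases :: "nat \<Rightarrow> nat set" where
  "fifth_bases a = {b. a \<in> square_bases b \<and> Z ^ 6 \<le> real b}"

text \<open>If \<open>b' < b\<close>, the two represented numbers differ by at least
  \<open>a ^ 2 * b' ^ 4\<close>, which is therefore at most \<open>Z ^ 19\<close>. As
  \<open>a ^ 2 * b' ^ 5\<close> exceeds \<open>Z ^ 36\<close>, this forces
  \<open>b' \<ge> Z ^ 17\<close>, whose fifth power is far beyond \<open>2 * Z ^ 36\<close>.\<close>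

lemma fifth_bases_unique:
  assumes "b \<in> fifth_bases a" "b' \<in> fifth_bases a"
  shows "b \<le> b'"
proof (rule ccontr)
  assume "\<not> b \<le> b'"
  then have less: "b' + 1 \<le> b" by simp
  have a: "1 \<le> a" "1 \<le> b'" using assms square_bases_pos by (auto simp: fifth_bases_def)
  have "real b' ^ 5 + real b' ^ 4 \<le> (real b' + 1) ^ 5"
    by (simp add: eval_nat_numeral algebra_simps)
  also have "\<dots> \<le> real b ^ 5" using less by (intro power_mono) auto
  finally have "real a ^ 2 * (real b' ^ 5 + real b' ^ 4) \<le> real a ^ 2 * real b ^ 5"
    by (intro mult_left_mono) auto
  then have "real a ^ 2 * real b' ^ 4 \<le> Z ^ 19"
    using assms y unfolding fifth_bases_def square_bases_def by (simp add: distrib_left)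
  then have "real a ^ 2 * real b' ^ 4 * real b' \<le> Z ^ 19 * real b'" by (intro mult_right_mono) auto
  moreover have "Z ^ 36 < real a ^ 2 * real b' ^ 4 * real b'"
    using assms(2) by (simp add: fifth_bases_def square_bases_def eval_nat_numeral mult_ac)
  ultimately have "Z ^ 19 * Z ^ 17 < Z ^ 19 * real b'" by (simp flip: power_add)
  then have big: "Z ^ 17 \<le> real b'" using Z_ge_1(2) by (simp only: mult_less_cancel_left_pos zero_less_power less_imp_le)
  have "(Z ^ 17) ^ 5 \<le> real b' ^ 5" using big Z_ge_1 by (intro power_mono) auto
  also have "\<dots> \<le> real a ^ 2 * real b' ^ 5" using a mult_right_mono[of 1 "real a ^ 2" "real b' ^ 5"] by simp
  also have "\<dots> \<le> 2 * Z ^ 36" using assms(2) target_le by (simp add: fifth_bases_def square_bases_def)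
  also have "\<dots> < Z * Z ^ 36" using Z Z_ge_1 by (intro mult_strict_right_mono) auto
  also have "\<dots> = Z ^ 37" by (simp flip: power_Suc)
  also have "\<dots> \<le> (Z ^ 17) ^ 5" unfolding power_mult[symmetric] using Z_ge_1 by (intro power_increasing) auto
  finally show False by simp
qed

lemma card_fifth_bases_le_1: "card (fifth_bases a) \<le> 1" "finite (fifth_bases a)"
proof -
  have "fifth_bases a \<subseteq> {b}" if "b \<in> fifth_bases a" for b using fifth_bases_unique that by (auto intro: antisym)
  then have "fifth_bases a = {} \<or> (\<exists>b. fifth_bases a = {b})" by blast
  then show "card (fifth_bases a) \<le> 1" "finite (fifth_bases a)" by auto
qed

lemma fifth_bases_bound:
  assumes "b \<in> fifth_bases a"
  shows "real a \<le> 2 * Z ^ 3"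
proof (rule power2_le_imp_le)
  have "real a ^ 2 * (Z ^ 6) ^ 5 \<le> real a ^ 2 * real b ^ 5"
    using assms Z_ge_1 by (intro mult_left_mono power_mono) (auto simp: fifth_bases_def)
  also have "\<dots> \<le> 2 * Z ^ 36" using assms target_le by (simp add: fifth_bases_def square_bases_def)
  also have "\<dots> \<le> (2 * Z ^ 3)\<^sup>2 * Z ^ 30" using Z_ge_1 by (simp add: power_mult_distrib flip: power_mult power_add)
  finally show "(real a)\<^sup>2 \<le> (2 * Z ^ 3)\<^sup>2"
    unfolding power_mult[symmetric] using Z_ge_1 by simp
qed (use Z_ge_1 in simp)

text \<open>Four ranges of \<open>b\<close>. Up to \<open>Z ^ 2\<close> each \<open>b\<close> has at
  most \<open>Z + 1\<close> values of \<open>a\<close>. From there on it has at most one: up to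
  \<open>Z ^ 3\<close> all \<open>b\<close> are counted, up to \<open>Z ^ 6\<close>
  \<open>card_mid\<close> applies. Beyond, each \<open>a \<le> 2 * Z ^ 3\<close> has at most one
  \<open>b\<close>.\<close>

lemma card_represented_power: "real (card (represented (Z ^ 36) y)) \<le> 10 ^ 31 * Z ^ 3 * ln Z"
proof -
  define B1 where "B1 = {b :: nat. 1 \<le> b \<and> real b \<le> Z\<^sup>2}"
  define B2 where "B2 = {b :: nat. 1 \<le> b \<and> real b \<le> Z ^ 3}"
  define B3 where "B3 = {b. Z ^ 3 \<le> real b \<and> real b \<le> Z ^ 6 \<and> square_bases b \<noteq> {}}"
  define A where "A = {a :: nat. 1 \<le> a \<and> real a \<le> 2 * Z ^ 3}"
  define B where "B = {b \<in> B2 \<union> B3. Z\<^sup>2 \<le> real b}"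
  have cardle: "finite {n :: nat. 1 \<le> n \<and> real n \<le> t} \<and> real (card {n :: nat. 1 \<le> n \<and> real n \<le> t}) \<le> t"
    if "0 \<le> t" for t :: real
  proof -
    have "{n :: nat. 1 \<le> n \<and> real n \<le> t} = {1..nat \<lfloor>t\<rfloor>}" using that by (auto simp: le_nat_floor le_nat_iff le_floor_iff)
    then show ?thesis using that by simp
  qed
  have B1: "finite B1" "real (card B1) \<le> Z\<^sup>2" using cardle[of "Z\<^sup>2"] by (auto simp: B1_def)
  have B2: "finite B2" "real (card B2) \<le> Z ^ 3" using cardle[of "Z ^ 3"] Z_ge_1 by (auto simp: B2_def)
  have A: "finite A" "real (card A) \<le> 2 * Z ^ 3" using cardle[of "2 * Z ^ 3"] Z_ge_1 by (auto simp: A_def)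
  have B3: "finite B3"
    by (rule finite_subset[of _ "{..nat \<lfloor>Z ^ 6\<rfloor>}"]) (auto simp: B3_def le_nat_floor)
  have finB: "finite B" using B2 B3 by (simp add: B_def)
  let ?g = "\<lambda>a b :: nat. a ^ 2 * b ^ 5"
  let ?P1 = "\<Union>b\<in>B1. (\<lambda>a. ?g a b) ` square_bases b" and ?P2 = "\<Union>b\<in>B. (\<lambda>a. ?g a b) ` square_bases b"
    and ?P3 = "\<Union>a\<in>A. ?g a ` fifth_bases a"
  have "represented (Z ^ 36) y \<subseteq> ?P1 \<union> (?P2 \<union> ?P3)"
  proof
    fix n assume "n \<in> represented (Z ^ 36) y"
    then obtain a b where n: "n = ?g a b" and square_bases: "a \<in> square_bases b" by (auto simp: represented_def square_bases_def)
    have pos: "1 \<le> a" "1 \<le> b" using square_bases_pos[OF square_bases] by auto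
    consider "b \<in> B1" | "b \<in> B" | "b \<in> fifth_bases a" "a \<in> A"
    proof (cases "real b \<le> Z ^ 6")
      case True
      then show ?thesis
        using that(1,2) pos square_bases by (cases "real b \<le> Z\<^sup>2"; cases "real b \<le> Z ^ 3") (auto simp: B1_def B2_def B3_def B_def)
    next
      case False
      then have "b \<in> fifth_bases a" using square_bases by (simp add: fifth_bases_def)
      then show ?thesis using that(3) fifth_bases_bound pos by (auto simp: A_def)
    qed
    then show "n \<in> ?P1 \<union> (?P2 \<union> ?P3)" using n square_bases by cases blast+
  qed
  moreover have "finite (?P1 \<union> (?P2 \<union> ?P3))" using B1 finB A finite_square_bases card_fifth_bases_le_1 by auto
  ultimately have "card (represented (Z ^ 36) y) \<le> card (?P1 \<union> (?P2 \<union> ?P3))" by (rule card_mono[rotated])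
  also have "\<dots> \<le> card ?P1 + (card ?P2 + card ?P3)"
    by (meson add_left_mono card_Un_le order_trans)
  also have "card ?P1 \<le> (\<Sum>b\<in>B1. card (square_bases b))"
    by (rule order_trans[OF card_UN_le[OF B1(1)] sum_mono]) (rule card_image_le[OF finite_square_bases])
  also have "card ?P2 \<le> (\<Sum>b\<in>B. 1)"
    by (rule order_trans[OF card_UN_le[OF finB] sum_mono])
       (use card_square_bases_le_1 in \<open>auto simp: B_def intro: order_trans[OF card_image_le[OF finite_square_bases]]\<close>)
  also have "card ?P3 \<le> (\<Sum>a\<in>A. 1)"
    by (rule order_trans[OF card_UN_le[OF A(1)] sum_mono])
       (use card_fifth_bases_le_1 in \<open>auto intro: order_trans[OF card_image_le]\<close>)
  finally have "card (represented (Z ^ 36) y) \<le> (\<Sum>b\<in>B1. card (square_bases b)) + (card B + card A)" by simp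
  then have "real (card (represented (Z ^ 36) y)) \<le> (\<Sum>b\<in>B1. real (card (square_bases b))) + (real (card B) + real (card A))"
    by (simp flip: of_nat_sum of_nat_add)
  also have "(\<Sum>b\<in>B1. real (card (square_bases b))) \<le> (\<Sum>b\<in>B1. Z + 1)"
    by (rule sum_mono) (use card_square_bases_le[of 1] in \<open>auto simp: B1_def\<close>)
  also have "\<dots> \<le> Z\<^sup>2 * (Z + 1)" using B1(2) Z_ge_1 by (simp add: mult_right_mono)
  also have "\<dots> \<le> Z\<^sup>2 * (2 * Z)" using Z_ge_1 by (intro mult_left_mono) auto
  also have "\<dots> = 2 * Z ^ 3" by (simp add: eval_nat_numeral)
  also have "real (card B) \<le> Z ^ 3 + 7 * ln Z * (10 ^ 30 * Z ^ 3)"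
  proof -
    have "card B \<le> card (B2 \<union> B3)" using B2 B3 by (intro card_mono) (auto simp: B_def)
    also have "\<dots> \<le> card B2 + card B3" by (rule card_Un_le)
    finally have "real (card B) \<le> real (card B2) + real (card B3)" by linarith
    then show ?thesis using B2(2) card_mid unfolding B3_def by linarith
  qed
  also note A(2)
  finally have le: "real (card (represented (Z ^ 36) y)) \<le> 5 * Z ^ 3 + 7 * ln Z * (10 ^ 30 * Z ^ 3)" by simp
  have "exp 1 \<le> Z" using e_less_272 Z by simp
  then have "1 \<le> ln Z" using Z_ge_1 by (simp add: ln_ge_iff)
  then have "1 * Z ^ 3 \<le> ln Z * Z ^ 3" using Z_ge_1 by (intro mult_right_mono) auto
  moreover have "0 \<le> Z ^ 3" using Z_ge_1 by simp
  ultimately show ?thesis using le by (simp add: mult_ac)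
qed

end

section \<open>Passage to general \<open>x\<close> and longer intervals\<close>

definition x_min :: real where "x_min = (10 ^ 100) ^ 36"

lemma x_min_ge: "10 ^ 100 \<le> x_min"
  unfolding x_min_def by (rule power_increasing[of 1 36 "10 ^ 100 :: real", unfolded power_one_right]) simp_all

lemma card_represented_le:
  assumes x: "x_min \<le> x" and y: "0 \<le> y" "y \<le> x powr (19/36)"
  shows "real (card (represented x y)) \<le> 10 ^ 31 * (x powr (1/12) * ln x)"
proof -
  define Z where "Z = x powr (1/36)"
  have x1: "1 \<le> x" using order_trans[OF x_min_ge x] by simp
  have pw: "Z ^ n = x powr (real n / 36)" for n
    using x1 by (simp add: Z_def powr_powr flip: powr_realpow)
  have Z0: "0 < Z" using x1 by (simp add: Z_def)
  have Z36: "Z ^ 36 = x" using x1 by (simp add: pw)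
  \<comment> \<open>\<open>x_min\<close> is a 36th power precisely so that
    \<open>Z = x powr (1/36)\<close> reaches the threshold \<open>10 ^ 100\<close>.\<close>
  have "(10 ^ 100) ^ 36 \<le> Z ^ 36" using x unfolding Z36 x_min_def .
  then have Z: "10 ^ 100 \<le> Z"
    by (subst (asm) power_mono_iff) (use Z0 in simp_all)
  have lnx: "ln Z = ln x / 36" using x1 by (simp add: Z_def ln_powr)
  have "real (card (represented (Z ^ 36) y)) \<le> 10 ^ 31 * Z ^ 3 * ln Z"
    by (rule card_represented_power) (use Z y in \<open>simp_all add: pw\<close>)
  also have "\<dots> = 10 ^ 31 * (x powr (1/12) * (ln x / 36))" by (simp add: pw lnx)
  also have "\<dots> \<le> 10 ^ 31 * (x powr (1/12) * ln x)"
    using x1 by (intro mult_left_mono) auto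
  finally show ?thesis using x1 by (simp add: pw)
qed

text \<open>The interval is cut into equal pieces of length at most \<open>h0\<close>, each covered
  by \<open>card_represented_le\<close>. Their number has order \<open>y / h0\<close>, and -19/36 +
  1/12 = -4/9.\<close>

lemma card_represented_split:
  assumes x: "x_min \<le> x" and y: "0 < y" "y \<le> x" "x powr (19/36) / 8 < y"
  shows "real (card (represented x y)) \<le> 10 ^ 33 * (y * x powr (-4/9) * ln x)"
proof -
  have x2: "2 \<le> x" using order_trans[OF x_min_ge x] by simp
  define h0 where "h0 = x powr (19/36) / 8"
  have h0: "0 < h0" using x2 by (simp add: h0_def)
  define k where "k = nat \<lceil>y / h0\<rceil>"
  have q: "1 < y / h0" using y(3) h0 by (simp add: h0_def[symmetric] field_simps)
  have k: "y / h0 \<le> real k" "real k \<le> y / h0 + 1" using q unfolding k_def by linarith+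
  have k0: "0 < real k" using k q by linarith
  define h where "h = y / real k"
  have h: "0 < h" "h \<le> h0" "real k * h = y"
    using y k k0 h0 by (simp_all add: h_def field_simps)
  have "represented x y \<subseteq> (\<Union>i<k. represented (x + real i * h) h)"
  proof
    fix n assume n: "n \<in> represented x y"
    define t where "t = (real n - x) / h"
    have t: "0 < t" "t \<le> real k" using n h by (auto simp: t_def represented_def field_simps)
    \<comment> \<open>The ceiling minus 1, rather than the floor, because the pieces are open on the
      left and closed on the right.\<close>
    define i where "i = nat (\<lceil>t\<rceil> - 1)"
    have i: "real i < t" "t \<le> real i + 1" using t unfolding i_def by linarith+
    have "i < k" using i t by linarith
    moreover have "x + real i * h < real n" "real n \<le> x + real i * h + h"
      using i h(1) by (simp_all add: t_def field_simps)
    ultimately show "n \<in> (\<Union>i<k. represented (x + real i * h) h)"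
      using n by (auto simp: represented_def)
  qed
  then have "card (represented x y) \<le> card (\<Union>i<k. represented (x + real i * h) h)"
    using finite_represented by (intro card_mono) auto
  also have "\<dots> \<le> (\<Sum>i<k. card (represented (x + real i * h) h))" by (rule card_UN_le) simp
  finally have "real (card (represented x y)) \<le> (\<Sum>i<k. real (card (represented (x + real i * h) h)))"
    by (simp flip: of_nat_sum)
  \<comment> \<open>All pieces start between \<open>x\<close> and \<open>2 * x\<close>, where the
    power 1/12 and the logarithm at most double.\<close>
  also have "\<dots> \<le> (\<Sum>i<k. 10 ^ 31 * (2 * x powr (1/12) * (2 * ln x)))"
  proof (rule sum_mono)
    fix i assume "i \<in> {..<k}"
    then have "real i * h \<le> real k * h" using h by (intro mult_right_mono) auto
    then have le: "x + real i * h \<le> 2 * x" using h y by simp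
    have ge: "x \<le> x + real i * h" using h by simp
    have "h0 \<le> x powr (19/36)" by (simp add: h0_def)
    then have "h \<le> x powr (19/36)" using h(2) by (rule order_trans[rotated])
    also have "\<dots> \<le> (x + real i * h) powr (19/36)" using ge x2 by (intro powr_mono2) auto
    finally have "real (card (represented (x + real i * h) h))
      \<le> 10 ^ 31 * ((x + real i * h) powr (1/12) * ln (x + real i * h))"
      using card_represented_le[of "x + real i * h" h] x ge h by simp
    also have "\<dots> \<le> 10 ^ 31 * (2 * x powr (1/12) * (2 * ln x))"
    proof (intro mult_left_mono mult_mono)
      have "(x + real i * h) powr (1/12) \<le> (2 * x) powr (1/12)" using ge le x2 by (intro powr_mono2) auto
      also have "\<dots> = 2 powr (1/12) * x powr (1/12)" using x2 by (simp add: powr_mult)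
      also have "\<dots> \<le> 2 powr 1 * x powr (1/12)" by (intro mult_right_mono powr_mono) auto
      finally show "(x + real i * h) powr (1/12) \<le> 2 * x powr (1/12)" by simp
      have "ln (x + real i * h) \<le> ln (2 * x)" using ge le x2 by simp
      also have "\<dots> = ln 2 + ln x" using x2 by (simp add: ln_mult)
      also have "\<dots> \<le> 2 * ln x" using x2 by simp
      finally show "ln (x + real i * h) \<le> 2 * ln x" .
      show "0 \<le> ln (x + real i * h)" using ge x2 by simp
    qed auto
    finally show "real (card (represented (x + real i * h) h)) \<le> 10 ^ 31 * (2 * x powr (1/12) * (2 * ln x))" .
  qed
  also have "\<dots> = real k * (4 * 10 ^ 31 * (x powr (1/12) * ln x))" by simp
  \<comment> \<open>\<open>k\<close> is at most \<open>y / h0 + 1\<close>, and \<open>y / h0\<close>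
    exceeds 1.\<close>
  also have "\<dots> \<le> (2 * (y / h0)) * (4 * 10 ^ 31 * (x powr (1/12) * ln x))"
    using k q x2 by (intro mult_right_mono) auto
  also have "y / h0 = 8 * (y * x powr (- 19/36))"
    using x2 by (simp add: h0_def powr_minus_divide)
  also have "2 * (8 * (y * x powr (- 19/36))) * (4 * 10 ^ 31 * (x powr (1/12) * ln x))
      = 64 * 10 ^ 31 * (y * (x powr (- 19/36) * x powr (1/12)) * ln x)" by (simp only: mult_ac)
  also have "x powr (- 19/36) * x powr (1/12) = x powr (-4/9)" by (simp flip: powr_add)
  also have "64 * 10 ^ 31 * (y * x powr (-4/9) * ln x) \<le> 10 ^ 33 * (y * x powr (-4/9) * ln x)"
    using y x2 by (intro mult_right_mono) auto
  finally show ?thesis .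
qed

theorem theorem7:
  shows "\<exists>c3::real. 0 < c3 \<and> c3 < 1/4 \<and>
    (\<exists>C1 C2 :: real. \<forall>\<^sub>F x :: real in at_top. \<forall>y :: real. y \<ge> 1 \<longrightarrow>
      (y \<le> c3 * x powr (11/20) \<longrightarrow>
        \<bar>real_of_int (\<Sum>n | x < real n \<and> real n \<le> x + y. lambda5_conv_one n)\<bar>
          \<le> C1 * ((x powr (1/12) + y * x powr (-4/9)) * ln x)) \<and>
      (y \<le> c3 * x powr (19/36) \<longrightarrow>
        \<bar>real_of_int (\<Sum>n | x < real n \<and> real n \<le> x + y. lambda5_conv_one n)\<bar>
          \<le> C2 * (x powr (1/12) * ln x)))"
proof -
  \<comment> \<open>1/8 is the factor in the length \<open>h0\<close> of
    \<open>card_represented_split\<close>, so the direct count and the cutting argument meet at the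
    same threshold for \<open>y\<close>.\<close>
  have main: "\<forall>\<^sub>F x :: real in at_top. \<forall>y :: real. y \<ge> 1 \<longrightarrow>
      (y \<le> 1/8 * x powr (11/20) \<longrightarrow>
        \<bar>real_of_int (\<Sum>n | x < real n \<and> real n \<le> x + y. lambda5_conv_one n)\<bar>
          \<le> 10 ^ 33 * ((x powr (1/12) + y * x powr (-4/9)) * ln x)) \<and>
      (y \<le> 1/8 * x powr (19/36) \<longrightarrow>
        \<bar>real_of_int (\<Sum>n | x < real n \<and> real n \<le> x + y. lambda5_conv_one n)\<bar>
          \<le> 10 ^ 31 * (x powr (1/12) * ln x))"
    using eventually_ge_at_top[of x_min]
  proof eventually_elim
    case (elim x)
    have x1: "1 \<le> x" using order_trans[OF x_min_ge elim] by simp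
    have le_card: "\<bar>real_of_int (\<Sum>n | x < real n \<and> real n \<le> x + y. lambda5_conv_one n)\<bar>
        \<le> real (card (represented x y))" for y
      using x1 by (intro abs_sum_le_card_represented) simp
    have small: "real (card (represented x y)) \<le> 10 ^ 31 * (x powr (1/12) * ln x)"
      if "1 \<le> y" "y \<le> 1/8 * x powr (19/36)" for y
      by (rule card_represented_le[OF elim]) (use that in auto)
    have large: "real (card (represented x y)) \<le> 10 ^ 33 * ((x powr (1/12) + y * x powr (-4/9)) * ln x)"
      if y: "1 \<le> y" "y \<le> 1/8 * x powr (11/20)" for y
    proof (cases "y \<le> 1/8 * x powr (19/36)")
      case True
      have "real (card (represented x y)) \<le> 10 ^ 31 * (x powr (1/12) * ln x)" by (rule small[OF y(1) True])
      also have "\<dots> \<le> 10 ^ 33 * ((x powr (1/12) + y * x powr (-4/9)) * ln x)"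
        using x1 y by (intro mult_mono mult_right_mono) auto
      finally show ?thesis .
    next
      case False
      \<comment> \<open>The exponent 11/20 enters through \<open>y \<le> x\<close>, which keeps the
        starting points of all pieces below \<open>2 * x\<close>.\<close>
      have "x powr (11/20) \<le> x powr 1" using x1 by (intro powr_mono) auto
      then have "y \<le> x" using y x1 by simp
      then have "real (card (represented x y)) \<le> 10 ^ 33 * (y * x powr (-4/9) * ln x)"
        using False y by (intro card_represented_split[OF elim]) auto
      also have "\<dots> \<le> 10 ^ 33 * ((x powr (1/12) + y * x powr (-4/9)) * ln x)"
        using x1 by (intro mult_left_mono mult_right_mono) auto
      finally show ?thesis .
    qed
    show ?case using le_card small large order_trans by blast
  qed
  show ?thesis
  proof (rule exI[of _ "1/8"], intro conjI)
    show "\<exists>C1 C2 :: real. \<forall>\<^sub>F x :: real in at_top. \<forall>y :: real. y \<ge> 1 \<longrightarrow>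
      (y \<le> 1/8 * x powr (11/20) \<longrightarrow>
        \<bar>real_of_int (\<Sum>n | x < real n \<and> real n \<le> x + y. lambda5_conv_one n)\<bar>
          \<le> C1 * ((x powr (1/12) + y * x powr (-4/9)) * ln x)) \<and>
      (y \<le> 1/8 * x powr (19/36) \<longrightarrow>
        \<bar>real_of_int (\<Sum>n | x < real n \<and> real n \<le> x + y. lambda5_conv_one n)\<bar>
          \<le> C2 * (x powr (1/12) * ln x))"
      by (rule exI[of _ "10 ^ 33"], rule exI[of _ "10 ^ 31"], rule main)
  qed simp_all
qed

end
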